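(* Let $(V,\mu)$ be a long-range percolation model with the Aizenman–Newman–Barsky property (in particular, $(V,\mu)$ may be any transitive long-range model), and let $o\in V$. Then the susceptibility $\chi(t)=\mathbb{E}_t(|C(o)|)$ is real-analytic in the interval $[0,t_c)$.
   Context: Long-range model: $V$ is a countably infinite set, $E$ is the set of (unordered) pairs $xy$ of elements of $V$, and $\mu:E\to\mathbb{R}_{\ge 0}$ satisfies $\sum_{y\in V}\mu(xy)=1$ for every $x\in V$. For $t\in[0,\infty)$, $\Pr_t$ (with expectation $\mathbb{E}_t$) is the law of the random graph on $V$ in which each edge $xy$ is independently vacant (absent) with probability $e^{-t\mu(xy)}$ and occupied (present) otherwise. $C(o)$ denotes the cluster of $o$, i.e. the connected component of $o$ in the graph formed by the occupied edges, and $|C(o)|$ is its number of vertices. The critical value is $t_c:=\sup\{t : \Pr_t(|C(o)|=\infty)=0\}$, which is understood not to depend on the choice of $o\in V$. The model is transitive if there is a group acting transitively on $V$ and preserving $\mu$. Aizenman–Newman–Barsky property: for every $t<t_c$ and every $o\in V$ there is a constant $c=c(t,o)>0$ such that $\Pr_t(|C(o)|\ge n)\le e^{-cn}$ for all sufficiently large $n$. A function $f$ on an interval $I\subset\mathbb{R}$ is (real-)analytic on $I$ if every $x\in I$ is the centre of an open disc $D\subset\mathbb{C}$ on which there is a holomorphic function agreeing with $f$ on $D\cap I$. *)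

theory Defs
  imports
    "HOL-Probability.Probability"
    "HOL-Complex_Analysis.Complex_Analysis"
    "HOL-Algebra.Group_Action"
begin

definition pairs :: "'v set \<Rightarrow> 'v set set" where
  "pairs V = {e. e \<subseteq> V \<and> card e = 2}"

text \<open>Edges are two-element sets; \<open>\<mu>\<close> is only relevant on \<^term>\<open>pairs V\<close>.\<close>

definition long_range_model :: "'v set \<Rightarrow> ('v set \<Rightarrow> real) \<Rightarrow> bool" where
  "long_range_model V \<mu> \<longleftrightarrow>
     countable V \<and> infinite V \<and>
     (\<forall>e\<in>pairs V. 0 \<le> \<mu> e) \<and>
     (\<forall>x\<in>V. ((\<lambda>y. \<mu> {x, y}) has_sum 1) (V - {x}))"

text \<open>
  A group acting on \<open>V\<close> enters only through its image in the bijections of \<open>V\<close>, so taking the group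
  elements of type \<^typ>\<open>'v \<Rightarrow> 'v\<close> is no restriction.
\<close>

definition transitive_model :: "'v set \<Rightarrow> ('v set \<Rightarrow> real) \<Rightarrow> bool" where
  "transitive_model V \<mu> \<longleftrightarrow>
     (\<exists>(G :: ('v \<Rightarrow> 'v) monoid) \<phi>. transitive_action G V \<phi> \<and>
        (\<forall>g\<in>carrier G. \<forall>e\<in>pairs V. \<mu> (\<phi> g ` e) = \<mu> e))"

text \<open>
  A configuration assigns \<^term>\<open>True\<close> to the occupied and \<^term>\<open>False\<close> to the vacant edges. Only
  parameters \<open>t \<ge> 0\<close> are meaningful.
\<close>

definition percolation :: "'v set \<Rightarrow> ('v set \<Rightarrow> real) \<Rightarrow> real \<Rightarrow> ('v set \<Rightarrow> bool) measure" where
  "percolation V \<mu> t =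
     PiM (pairs V) (\<lambda>e. measure_pmf (bernoulli_pmf (1 - exp (- t * \<mu> e))))"

definition cluster :: "'v set \<Rightarrow> ('v set \<Rightarrow> bool) \<Rightarrow> 'v \<Rightarrow> 'v set" where
  "cluster V \<omega> v = {x. (v, x) \<in> {(y, z). {y, z} \<in> pairs V \<and> \<omega> {y, z}}\<^sup>*}"

text \<open>The number of vertices of the cluster, with value \<open>\<infinity>\<close> if the cluster is infinite.\<close>

definition cluster_size :: "'v set \<Rightarrow> ('v set \<Rightarrow> bool) \<Rightarrow> 'v \<Rightarrow> ennreal" where
  "cluster_size V \<omega> v = emeasure (count_space UNIV) (cluster V \<omega> v)"

text \<open>
  The critical value may be \<open>\<infinity>\<close>. It is customarily understood not to depend on the vertex \<open>v\<close>;
  since this can fail for models that are not irreducible, the vertex is kept as an argument.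
\<close>

definition critical_value :: "'v set \<Rightarrow> ('v set \<Rightarrow> real) \<Rightarrow> 'v \<Rightarrow> ereal" where
  "critical_value V \<mu> v =
     (SUP t \<in> {t. 0 \<le> t \<and> \<P>(\<omega> in percolation V \<mu> t. cluster_size V \<omega> v = \<infinity>) = 0}. ereal t)"

definition ANB_property :: "'v set \<Rightarrow> ('v set \<Rightarrow> real) \<Rightarrow> bool" where
  "ANB_property V \<mu> \<longleftrightarrow>
     (\<forall>v\<in>V. \<forall>t\<ge>0. ereal t < critical_value V \<mu> v \<longrightarrow>
        (\<exists>c>0. \<forall>\<^sub>F n in sequentially.
           \<P>(\<omega> in percolation V \<mu> t. of_nat n \<le> cluster_size V \<omega> v) \<le> exp (- c * real n)))"

definition susceptibility :: "'v set \<Rightarrow> ('v set \<Rightarrow> real) \<Rightarrow> 'v \<Rightarrow> real \<Rightarrow> ennreal" where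
  "susceptibility V \<mu> v t = (\<integral>\<^sup>+ \<omega>. cluster_size V \<omega> v \<partial>percolation V \<mu> t)"

definition real_analytic_on :: "(real \<Rightarrow> real) \<Rightarrow> real set \<Rightarrow> bool" (infix "real'_analytic'_on" 50) where
  "f real_analytic_on I \<longleftrightarrow>
     (\<forall>x\<in>I. \<exists>r>0. \<exists>F. F holomorphic_on ball (complex_of_real x) r \<and>
        (\<forall>y\<in>I. complex_of_real y \<in> ball (complex_of_real x) r \<longrightarrow>
           F (complex_of_real y) = complex_of_real (f y)))"

end

theory Submission
  imports Defs
begin

text \<open>
  Revealing the edges of a finite graph one at a time, always an edge leaving the part of the cluster
  found so far, gives two comparison principles by induction.

  For sharpness, the expectation of an increasing function of \<open>|C|\<close> at the smaller parameter is at
  most its expectation at the larger parameter under the law tilted by \<open>exp (- h |C|)\<close>: the tilt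
  lowers the conditional probability of a revealed edge by at most the factor
  \<open>E (exp (- h |C|)) \<ge> 1 - m\<close>. Since \<open>m\<close> becomes arbitrarily small as \<open>h \<rightarrow> 0\<close> when there is no
  infinite cluster, \<open>|C|\<close> has exponential tails just below. This is Vanneuville's stochastic comparison.

  For analyticity, replacing \<open>t\<close> by a complex \<open>z\<close> changes the weight of a revealed edge \<open>e\<close>, vacant or
  occupied, by at most the factor \<open>exp ((|z| - Re z) \<mu> e)\<close> compared with the parameter \<open>|z|\<close>. The
  revealed edges touch the cluster, hence have total weight at most \<open>|C|\<close>, and the exponential
  tails bound the finite-volume susceptibilities uniformly near \<open>t\<close>. Montel's theorem then provides a
  holomorphic limit.
\<close>

section \<open>Finite Bernoulli expectations\<close>

text \<open>The weights are not required to be probabilities, so that complex parameters are included.\<close>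

definition bexp :: "('e \<Rightarrow> 'a::comm_ring_1) \<Rightarrow> 'e set \<Rightarrow> ('e set \<Rightarrow> 'a) \<Rightarrow> 'a" where
  "bexp p U F = (\<Sum>X\<in>Pow U. (\<Prod>e\<in>X. p e) * (\<Prod>e\<in>U - X. 1 - p e) * F X)"

lemma bexp_empty [simp]: "bexp p {} F = F {}"
  by (simp add: bexp_def)

lemma bexp_cong: "(\<And>X. X \<subseteq> U \<Longrightarrow> F X = G X) \<Longrightarrow> bexp p U F = bexp p U G"
  unfolding bexp_def by (rule sum.cong) auto

lemma bexp_cmult: "bexp p U (\<lambda>X. c * F X) = c * bexp p U F"
  unfolding bexp_def sum_distrib_left by (rule sum.cong) (auto simp: algebra_simps)

lemma bexp_sum: "bexp p U (\<lambda>X. \<Sum>i\<in>S. F i X) = (\<Sum>i\<in>S. bexp p U (F i))"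
  unfolding bexp_def sum_distrib_left by (rule sum.swap)

lemma bexp_diff: "bexp p U (\<lambda>X. F X - G X) = bexp p U F - bexp p U G"
  unfolding bexp_def by (simp add: right_diff_distrib sum_subtractf)

lemma bexp_of_real:
  "bexp (\<lambda>e. of_real (p e)) U (\<lambda>X. of_real (F X)) = (of_real (bexp p U F) :: complex)"
  by (simp add: bexp_def)

text \<open>Conditioning on the state of one edge. The inductions over edge sets, also those with
  complex weights, run through this recursion.\<close>

lemma bexp_insert:
  assumes "finite U" "e \<notin> U"
  shows "bexp p (insert e U) F = (1 - p e) * bexp p U F + p e * bexp p U (\<lambda>X. F (insert e X))"
proof -
  let ?t = "\<lambda>X. (\<Prod>e\<in>X. p e) * (\<Prod>e\<in>insert e U - X. 1 - p e) * F X"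
  have "bexp p (insert e U) F = sum ?t (Pow U) + sum ?t (insert e ` Pow U)"
    unfolding bexp_def Pow_insert using assms by (intro sum.union_disjoint) auto
  also have "sum ?t (Pow U) = (1 - p e) * bexp p U F"
    unfolding bexp_def sum_distrib_left
  proof (rule sum.cong)
    fix X assume "X \<in> Pow U"
    then have "insert e U - X = insert e (U - X)" "e \<notin> U - X" "finite (U - X)"
      using assms by auto
    then show "?t X = (1 - p e) * ((\<Prod>e\<in>X. p e) * (\<Prod>e\<in>U - X. 1 - p e) * F X)"
      by (simp add: algebra_simps)
  qed simp
  also have "sum ?t (insert e ` Pow U) = sum (?t \<circ> insert e) (Pow U)"
    using assms by (intro sum.reindex inj_onI) (metis PowD insert_ident subsetD)
  also have "\<dots> = p e * bexp p U (\<lambda>X. F (insert e X))"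
    unfolding bexp_def sum_distrib_left
  proof (rule sum.cong)
    fix X assume X: "X \<in> Pow U"
    then have "insert e U - insert e X = U - X" "e \<notin> X" "finite X"
      using assms finite_subset[of X U] by auto
    then show "(?t \<circ> insert e) X =
        p e * ((\<Prod>e\<in>X. p e) * (\<Prod>e\<in>U - X. 1 - p e) * F (insert e X))"
      by (simp add: algebra_simps)
  qed simp
  finally show ?thesis .
qed

lemma bexp_const: "finite U \<Longrightarrow> bexp p U (\<lambda>X. c) = c"
  by (induction U rule: finite_induct) (simp_all add: bexp_insert algebra_simps)

lemma bexp_mono:
  fixes p :: "'e \<Rightarrow> real"
  assumes "\<And>e. e \<in> U \<Longrightarrow> 0 \<le> p e \<and> p e \<le> 1" "\<And>X. X \<subseteq> U \<Longrightarrow> F X \<le> G X"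
  shows "bexp p U F \<le> bexp p U G"
  unfolding bexp_def using assms
  by (intro sum_mono mult_left_mono mult_nonneg_nonneg prod_nonneg) auto

text \<open>Condition on one edge: both conditional means are lower when it is occupied, so they
  vary in the same direction and their covariance is nonnegative.\<close>

lemma bexp_Harris:
  fixes p :: "'e \<Rightarrow> real"
  assumes "finite U" "\<And>e. e \<in> U \<Longrightarrow> 0 \<le> p e \<and> p e \<le> 1"
    "\<And>X Y. X \<subseteq> Y \<Longrightarrow> Y \<subseteq> U \<Longrightarrow> F Y \<le> F X"
    "\<And>X Y. X \<subseteq> Y \<Longrightarrow> Y \<subseteq> U \<Longrightarrow> G Y \<le> G X"
  shows "bexp p U F * bexp p U G \<le> bexp p U (\<lambda>X. F X * G X)"
  using assms
proof (induction U arbitrary: F G rule: finite_induct)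
  case (insert e U)
  let ?F = "\<lambda>X. F (insert e X)" and ?G = "\<lambda>X. G (insert e X)"
  define r where "r = p e"
  have r: "0 \<le> r" "r \<le> 1" using insert.prems(1) by (auto simp: r_def)
  have 0: "bexp p U F * bexp p U G \<le> bexp p U (\<lambda>X. F X * G X)"
    by (intro insert.IH insert.prems) auto
  have 1: "bexp p U ?F * bexp p U ?G \<le> bexp p U (\<lambda>X. ?F X * ?G X)"
    by (intro insert.IH insert.prems) auto
  have 2: "bexp p U ?F \<le> bexp p U F" "bexp p U ?G \<le> bexp p U G"
    by (intro bexp_mono insert.prems; auto)+
  \<comment> \<open>This product is the covariance of the two conditional means, viewed as functions
    of the state of \<open>e\<close>. Expanding it gives the next inequality.\<close>
  have "0 \<le> r * (1 - r) * ((bexp p U F - bexp p U ?F) * (bexp p U G - bexp p U ?G))"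
    using r 2 by (intro mult_nonneg_nonneg) auto
  then have "((1 - r) * bexp p U F + r * bexp p U ?F) * ((1 - r) * bexp p U G + r * bexp p U ?G)
    \<le> (1 - r) * (bexp p U F * bexp p U G) + r * (bexp p U ?F * bexp p U ?G)"
    by (simp add: algebra_simps)
  also have "\<dots> \<le> (1 - r) * bexp p U (\<lambda>X. F X * G X) + r * bexp p U (\<lambda>X. ?F X * ?G X)"
    using r 0 1 by (intro add_mono mult_left_mono) auto
  finally show ?case
    using insert.hyps by (simp add: bexp_insert r_def)
qed simp

text \<open>Takes the place of a monotone coupling. The edges are changed from \<open>p\<close> to
  \<open>q\<close> one at a time, and occupying an edge can only raise the mean of an increasing
  \<open>F\<close>.\<close>

lemma bexp_mono_prob:
  fixes p q :: "'e \<Rightarrow> real"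
  assumes "finite U" "\<And>e. e \<in> U \<Longrightarrow> 0 \<le> p e \<and> p e \<le> q e \<and> q e \<le> 1"
    "\<And>X Y. X \<subseteq> Y \<Longrightarrow> Y \<subseteq> U \<Longrightarrow> F X \<le> F Y"
  shows "bexp p U F \<le> bexp q U F"
  using assms
proof (induction U arbitrary: F rule: finite_induct)
  case (insert e U)
  let ?F = "\<lambda>X. F (insert e X)"
  have pq: "0 \<le> p e" "p e \<le> q e" "q e \<le> 1" using insert.prems(1) by auto
  have 0: "bexp p U F \<le> bexp q U F"
    by (intro insert.IH insert.prems) auto
  have 1: "bexp p U ?F \<le> bexp q U ?F"
    by (intro insert.IH insert.prems) auto
  have 2: "bexp q U F \<le> bexp q U ?F"
    by (intro bexp_mono insert.prems(2)) (use insert.prems(1) in \<open>auto intro: order_trans\<close>)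
  have "(1 - p e) * bexp p U F + p e * bexp p U ?F \<le> (1 - p e) * bexp q U F + p e * bexp q U ?F"
    using pq 0 1 by (intro add_mono mult_left_mono) auto
  also have "\<dots> = bexp q U F + p e * (bexp q U ?F - bexp q U F)"
    by (simp add: algebra_simps)
  also have "\<dots> \<le> bexp q U F + q e * (bexp q U ?F - bexp q U F)"
    using pq 2 by (intro add_mono mult_right_mono) auto
  finally show ?case
    using insert.hyps by (simp add: bexp_insert algebra_simps)
qed simp

section \<open>Exploration of a cluster\<close>

text \<open>The start is a set rather than a vertex, so that the exploration can enlarge it.\<close>

definition reach :: "'v set set \<Rightarrow> 'v set \<Rightarrow> 'v set" where
  "reach X A = {(y, z). {y, z} \<in> X}\<^sup>* `` A"

lemma reach_mono: "X \<subseteq> Y \<Longrightarrow> A \<subseteq> B \<Longrightarrow> reach X A \<subseteq> reach Y B"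
  unfolding reach_def by (intro Image_mono rtrancl_mono) auto

lemma subset_reach: "A \<subseteq> reach X A"
  unfolding reach_def by auto

lemma reach_Un: "reach X (A \<union> B) = reach X A \<union> reach X B"
  unfolding reach_def by auto

lemma reach_step: "y \<in> reach X A \<Longrightarrow> {y, z} \<in> X \<Longrightarrow> z \<in> reach X A"
  unfolding reach_def by (auto intro: rtrancl_into_rtrancl)

lemma reach_least:
  assumes "A \<subseteq> R" "\<And>y z. y \<in> R \<Longrightarrow> {y, z} \<in> X \<Longrightarrow> z \<in> R"
  shows "reach X A \<subseteq> R"
proof -
  have "z \<in> R" if "(y, z) \<in> {(y, z). {y, z} \<in> X}\<^sup>*" "y \<in> A" for y z
    using that by (induction rule: rtrancl_induct) (use assms in auto)
  then show ?thesis unfolding reach_def by auto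
qed

lemma reach_insert:
  assumes "x \<in> A"
  shows "reach (insert {x, y} X) A = reach X (insert y A)"
proof
  have "x \<in> reach X (insert y A)" "y \<in> reach X (insert y A)"
    using assms subset_reach[of "insert y A" X] by auto
  then show "reach (insert {x, y} X) A \<subseteq> reach X (insert y A)"
    using subset_reach[of "insert y A" X]
    by (intro reach_least) (auto simp: doubleton_eq_iff intro: reach_step)
  have "y \<in> reach (insert {x, y} X) A"
    by (rule reach_step[OF subsetD[OF subset_reach assms]]) simp
  then show "reach X (insert y A) \<subseteq> reach (insert {x, y} X) A"
    using subset_reach[of A "insert {x, y} X"]
    by (intro reach_least) (simp, blast intro: reach_step)
qed

lemma finite_reach:
  assumes "finite X" "\<And>e. e \<in> X \<Longrightarrow> finite e" "finite A"
  shows "finite (reach X A)"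
proof (rule finite_subset)
  show "reach X A \<subseteq> A \<union> \<Union>X" by (rule reach_least) auto
qed (use assms in auto)

text \<open>\<open>U\<close> is the set of unrevealed edges and \<open>A\<close> the part of the cluster found so far.\<close>

lemma explore_induct [consumes 1, case_names closed step]:
  assumes "finite U"
    and "\<And>U A. finite U \<Longrightarrow> (\<And>x y. x \<in> A \<Longrightarrow> {x, y} \<in> U \<Longrightarrow> y \<in> A) \<Longrightarrow> P U A"
    and "\<And>U A x y. finite U \<Longrightarrow> {x, y} \<notin> U \<Longrightarrow> x \<in> A \<Longrightarrow> y \<notin> A \<Longrightarrow> P U A \<Longrightarrow> P U (insert y A) \<Longrightarrow>
      P (insert {x, y} U) A"
  shows "P U A"
  using assms(1)
proof (induction "card U" arbitrary: U A rule: less_induct)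
  case (less U A)
  show ?case
  proof (cases "\<forall>x y. x \<in> A \<longrightarrow> {x, y} \<in> U \<longrightarrow> y \<in> A")
    case True
    show ?thesis by (rule assms(2)[OF less.prems, of A]) (use True in blast)
  next
    case False
    then obtain x y where xy: "x \<in> A" "y \<notin> A" "{x, y} \<in> U" by blast
    \<comment> \<open>Revealing the edge leaves fewer edges in both cases. As \<open>A\<close> is
      arbitrary in the induction, the hypothesis covers \<open>A\<close> (vacant) and
      \<open>insert y A\<close> (occupied).\<close>
    then have c: "card (U - {{x, y}}) < card U"
      using less.prems by (intro card_Diff1_less)
    have "P (insert {x, y} (U - {{x, y}})) A"
      by (rule assms(3)) (use xy less.prems in \<open>auto intro: less.hyps[OF c]\<close>)
    then show ?thesis using xy by (simp add: insert_absorb)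
  qed
qed

text \<open>The exploration has stopped: with no unrevealed edge leaving \<open>A\<close>, every
  configuration yields the cluster \<open>A\<close>.\<close>

lemma bexp_reach_closed:
  assumes "finite U" "\<And>x y. x \<in> A \<Longrightarrow> {x, y} \<in> U \<Longrightarrow> y \<in> A"
  shows "bexp p U (\<lambda>X. F (reach X A)) = F A"
proof -
  have "reach X A = A" if "X \<subseteq> U" for X
    using assms that subset_reach[of A X] by (intro equalityI reach_least) auto
  then have "bexp p U (\<lambda>X. F (reach X A)) = bexp p U (\<lambda>X. F A)"
    by (intro bexp_cong) auto
  then show ?thesis using assms by (simp add: bexp_const)
qed

lemma bexp_reach_step:
  assumes "finite U" "{x, y} \<notin> U" "x \<in> A"
  shows "bexp p (insert {x, y} U) (\<lambda>X. F (reach X A)) =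
    (1 - p {x, y}) * bexp p U (\<lambda>X. F (reach X A)) +
    p {x, y} * bexp p U (\<lambda>X. F (reach X (insert y A)))"
  using assms by (simp add: bexp_insert reach_insert)

lemma card_reach_mono:
  assumes "X \<subseteq> Y" "A \<subseteq> B" "finite Y" "\<And>e. e \<in> Y \<Longrightarrow> finite e" "finite B"
  shows "card (reach X A) \<le> card (reach Y B)"
  using assms by (intro card_mono finite_reach reach_mono) auto

section \<open>Comparison with an exponentially tilted law\<close>

text \<open>Dividing by the second factor on the left gives a domination of the
  \<open>q\<close>-mean by a tilted \<open>p\<close>-mean; the form without division suits the
  induction. The lower bound \<open>1 - m\<close> is assumed for all finite edge sets in
  \<open>E\<close> and all vertices, since the exploration shrinks \<open>U\<close> and may add any
  vertex.\<close>

lemma tilted_domination: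
  fixes p q :: "'v set \<Rightarrow> real" and f :: "nat \<Rightarrow> real" and h m :: real
  assumes "finite U" "U \<subseteq> E" "finite A" "\<And>e. e \<in> E \<Longrightarrow> finite e"
    and pq: "\<And>e. e \<in> E \<Longrightarrow> 0 \<le> q e \<and> q e \<le> (1 - m) * p e \<and> p e \<le> 1 \<and> 0 \<le> p e \<and> q e \<le> 1"
    and "0 \<le> h" "mono f"
    and m: "\<And>U y. finite U \<Longrightarrow> U \<subseteq> E \<Longrightarrow> y \<in> \<Union>E \<Longrightarrow>
      1 - m \<le> bexp p U (\<lambda>X. exp (- h * card (reach X {y})))"
  shows "bexp q U (\<lambda>X. f (card (reach X A))) * bexp p U (\<lambda>X. exp (- h * card (reach X A)))
    \<le> bexp p U (\<lambda>X. f (card (reach X A)) * exp (- h * card (reach X A)))"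
  using assms(1-3)
proof (induction U A rule: explore_induct)
  case (closed U A)
  then show ?case
    using bexp_reach_closed[of U A p "\<lambda>C. f (card C) * exp (- h * card C)"]
      bexp_reach_closed[of U A p "\<lambda>C. exp (- h * card C)"]
      bexp_reach_closed[of U A q "\<lambda>C. f (card C)"] by simp
next
  case (step U A x y)
  let ?e = "{x, y}" and ?g = "\<lambda>C. exp (- h * real (card C))"
  have eE: "?e \<in> E" "U \<subseteq> E" "y \<in> \<Union>E" using step by auto
  have fin: "\<And>X. X \<subseteq> U \<Longrightarrow> finite X" "\<And>e. e \<in> U \<Longrightarrow> finite e"
    using step.hyps assms(4) eE finite_subset by auto
  \<comment> \<open>The constants \<open>a\<close> and \<open>b\<close> normalise the tilted law
    after the revealed edge is found vacant or occupied; \<open>Fa\<close> and \<open>Fb\<close> are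
    the corresponding untilted means under \<open>q\<close>.\<close>
  define a where "a = bexp p U (\<lambda>X. ?g (reach X A))"
  define b where "b = bexp p U (\<lambda>X. ?g (reach X (insert y A)))"
  define Fa where "Fa = bexp q U (\<lambda>X. f (card (reach X A)))"
  define Fb where "Fb = bexp q U (\<lambda>X. f (card (reach X (insert y A))))"
  define r where "r = p ?e"
  define s where "s = q ?e"
  have rs: "0 \<le> s" "s \<le> (1 - m) * r" "r \<le> 1" "0 \<le> r" "s \<le> 1" using pq eE by (auto simp: r_def s_def)
  have pU: "\<And>e. e \<in> U \<Longrightarrow> 0 \<le> p e \<and> p e \<le> 1" "\<And>e. e \<in> U \<Longrightarrow> 0 \<le> q e \<and> q e \<le> 1"
    using pq eE by auto
  have cm: "card (reach X C) \<le> card (reach Y D)" if "X \<subseteq> Y" "Y \<subseteq> U" "C \<subseteq> D" "finite D" for X Y C D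
    using that fin by (intro card_reach_mono) auto
  have IH: "Fa * a \<le> bexp p U (\<lambda>X. f (card (reach X A)) * ?g (reach X A))"
    "Fb * b \<le> bexp p U (\<lambda>X. f (card (reach X (insert y A))) * ?g (reach X (insert y A)))"
    using step unfolding a_def b_def Fa_def Fb_def by auto
  have Fab: "Fa \<le> Fb" unfolding Fa_def Fb_def
    using step.prems by (intro bexp_mono pU monoD[OF \<open>mono f\<close>] cm) auto
  have ba: "b \<le> a" unfolding a_def b_def
    using step.prems \<open>0 \<le> h\<close> by (intro bexp_mono pU) (auto intro!: mult_left_mono cm)
  have b0: "0 \<le> b"
    unfolding b_def bexp_def using pU by (intro sum_nonneg mult_nonneg_nonneg prod_nonneg) auto
  \<comment> \<open>By Harris and subadditivity, adding \<open>y\<close> costs at most the factor \<open>1 - m\<close>.\<close>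
  have "a * (1 - m) \<le> a * bexp p U (\<lambda>X. ?g (reach X {y}))"
    using b0 ba eE step.hyps by (intro mult_left_mono m) auto
  also have "\<dots> \<le> bexp p U (\<lambda>X. ?g (reach X A) * ?g (reach X {y}))"
    unfolding a_def using \<open>0 \<le> h\<close> step.prems step.hyps
    by (intro bexp_Harris pU) (auto intro!: mult_left_mono cm)
  also have "\<dots> \<le> b" unfolding b_def
  proof (intro bexp_mono pU)
    fix X assume X: "X \<subseteq> U"
    have "card (reach X (insert y A)) \<le> card (reach X A) + card (reach X {y})"
      using reach_Un[of X A "{y}"] card_Un_le[of "reach X A" "reach X {y}"] by simp
    then have "h * card (reach X (insert y A)) \<le> h * (card (reach X A) + card (reach X {y}))"
      using \<open>0 \<le> h\<close> by (intro mult_left_mono) linarith+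
    then show "?g (reach X A) * ?g (reach X {y}) \<le> ?g (reach X (insert y A))"
      by (simp add: exp_add[symmetric] algebra_simps)
  qed auto
  finally have ab: "a * (1 - m) \<le> b" .
  \<comment> \<open>Before \<open>?e\<close> is revealed, the tilted law is normalised by
    \<open>D\<close>, so \<open>r * b / D\<close> is the tilted probability that \<open>?e\<close>
    is occupied. The aim is \<open>s * D \<le> r * b\<close>: this probability is at least
    \<open>s\<close>.\<close>
  define D where "D = (1 - r) * a + r * b"
  have "s * D \<le> s * a"
    using rs ba unfolding D_def
    by (intro mult_left_mono) (use mult_left_mono[OF ba, of r] in \<open>auto simp: algebra_simps\<close>)
  also have "\<dots> \<le> (1 - m) * r * a"
    using rs b0 ba by (intro mult_right_mono) auto
  also have "\<dots> \<le> r * b"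
    using mult_left_mono[OF ab, of r] rs by (simp add: algebra_simps)
  finally have sD: "s * D \<le> r * b" .
  \<comment> \<open>The left side averages \<open>Fa \<le> Fb\<close>. Raising the weight of
    \<open>Fb\<close> from \<open>s\<close> to the tilted probability can only increase the
    average.\<close>
  have "((1 - s) * Fa + s * Fb) * D = Fa * D + (Fb - Fa) * (s * D)"
    by (simp add: algebra_simps)
  also have "\<dots> \<le> Fa * D + (Fb - Fa) * (r * b)"
    using sD Fab by (intro add_left_mono mult_left_mono) auto
  also have "\<dots> = (1 - r) * (Fa * a) + r * (Fb * b)"
    by (simp add: D_def algebra_simps)
  also have "\<dots> \<le> (1 - r) * bexp p U (\<lambda>X. f (card (reach X A)) * ?g (reach X A)) +
      r * bexp p U (\<lambda>X. f (card (reach X (insert y A))) * ?g (reach X (insert y A)))"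
    using IH rs by (intro add_mono mult_left_mono) auto
  also have "\<dots> = bexp p (insert ?e U) (\<lambda>X. f (card (reach X A)) * ?g (reach X A))"
    using bexp_reach_step[of U x y A p "\<lambda>C. f (card C) * ?g C"] step.hyps by (simp add: r_def)
  finally show ?case
    using bexp_reach_step[of U x y A p ?g] bexp_reach_step[of U x y A q "\<lambda>C. f (card C)"] step.hyps
    by (simp add: r_def s_def a_def b_def Fa_def Fb_def D_def)
qed

section \<open>Complex parameters compared with real ones\<close>

lemma norm_exp_minus_1_le: "norm (exp z - 1 :: complex) \<le> exp (norm z) - 1"
proof -
  have s: "summable (\<lambda>n. inverse (fact (n + 1)) * norm z ^ (n + 1))"
    using summable_exp_generic[of "norm z"] by (subst summable_iff_shift) (simp add: scaleR_conv_of_real)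
  have eq: "norm ((z ^ (n + 1)) /\<^sub>R fact (n + 1)) = inverse (fact (n + 1)) * norm z ^ (n + 1)" for n
    by (simp add: norm_power norm_mult)
  \<comment> \<open>Without their constant terms the two exponential series are compared term by
    term.\<close>
  have "exp z - 1 = (\<Sum>n. (z ^ (n + 1)) /\<^sub>R fact (n + 1))"
    using exp_first_term[of z] by simp
  also have "norm \<dots> \<le> (\<Sum>n. norm ((z ^ (n + 1)) /\<^sub>R fact (n + 1)))"
    using s unfolding eq[symmetric] by (rule summable_norm)
  also have "\<dots> = exp (norm z) - 1"
    unfolding eq using exp_first_term[of "norm z"] by simp
  finally show ?thesis .
qed

text \<open>Each revealed edge costs a factor \<open>exp (\<delta> * \<mu> e)\<close>, while
  unrevealed edges have total weight 1 and cost nothing. Every revealed edge touches the final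
  cluster, so the sum over touching edges bounds the total cost.\<close>

lemma norm_bexp_complex_le:
  fixes z :: complex and \<mu> :: "'v set \<Rightarrow> real" and f :: "'v set \<Rightarrow> real"
  assumes "finite U" "\<And>e. e \<in> U \<Longrightarrow> 0 \<le> \<mu> e"
  defines "\<delta> \<equiv> norm z - Re z"
  shows "norm (bexp (\<lambda>e. 1 - exp (- z * of_real (\<mu> e))) U (\<lambda>X. of_real (f (reach X A))))
    \<le> bexp (\<lambda>e. 1 - exp (- norm z * \<mu> e)) U
        (\<lambda>X. \<bar>f (reach X A)\<bar> * exp (\<delta> * sum \<mu> {e\<in>U. e \<inter> reach X A \<noteq> {}}))"
  using assms(1,2)
proof (induction U A rule: explore_induct)
  case (closed U A)
  have "0 \<le> \<delta>" by (simp add: \<delta>_def complex_Re_le_cmod)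
  moreover have "0 \<le> sum \<mu> {e\<in>U. e \<inter> A \<noteq> {}}" using closed by (intro sum_nonneg) auto
  \<comment> \<open>Once exploration stops there is no cost left; the exponential, being at least 1,
    is a free upper bound.\<close>
  ultimately have "\<bar>f A\<bar> * 1 \<le> \<bar>f A\<bar> * exp (\<delta> * sum \<mu> {e\<in>U. e \<inter> A \<noteq> {}})"
    by (intro mult_left_mono) auto
  then show ?case
    using bexp_reach_closed[of U A "\<lambda>e. 1 - exp (- z * of_real (\<mu> e))" "\<lambda>C. of_real (f C)"]
      bexp_reach_closed[of U A "\<lambda>e. 1 - exp (- norm z * \<mu> e)"
        "\<lambda>C. \<bar>f C\<bar> * exp (\<delta> * sum \<mu> {e\<in>U. e \<inter> C \<noteq> {}})"] closed by simp
next
  case (step U A x y)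
  let ?e = "{x, y}"
  let ?B = "\<lambda>A. bexp (\<lambda>e. 1 - exp (- z * of_real (\<mu> e))) U (\<lambda>X. of_real (f (reach X A)))"
  let ?w = "\<lambda>U C. \<bar>f C\<bar> * exp (\<delta> * sum \<mu> {e\<in>U. e \<inter> C \<noteq> {}})"
  let ?p = "\<lambda>e. 1 - exp (- norm z * \<mu> e)"
  let ?R = "\<lambda>U A. bexp ?p U (\<lambda>X. ?w U (reach X A))"
  let ?k = "exp (\<delta> * \<mu> ?e)"
  have \<mu>0: "0 \<le> \<mu> ?e" using step.prems by auto
  have IH: "norm (?B A) \<le> ?R U A" "norm (?B (insert y A)) \<le> ?R U (insert y A)"
    using step by auto
  have n1: "norm (exp (- z * of_real (\<mu> ?e))) = ?k * exp (- norm z * \<mu> ?e)"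
    by (simp add: \<delta>_def exp_add[symmetric] algebra_simps)
  \<comment> \<open>Factoring out the vacant weight, whose norm is known exactly, leaves
    \<open>exp (z * of_real (\<mu> ?e)) - 1\<close>, to which the series bound applies.\<close>
  have "1 - exp (- z * of_real (\<mu> ?e)) = exp (- z * of_real (\<mu> ?e)) * (exp (z * of_real (\<mu> ?e)) - 1)"
    by (simp add: algebra_simps exp_add[symmetric])
  then have "norm (1 - exp (- z * of_real (\<mu> ?e))) =
      ?k * exp (- norm z * \<mu> ?e) * norm (exp (z * of_real (\<mu> ?e)) - 1)"
    using n1 by (simp add: norm_mult)
  also have "\<dots> \<le> ?k * exp (- norm z * \<mu> ?e) * (exp (norm z * \<mu> ?e) - 1)"
    using norm_exp_minus_1_le[of "z * of_real (\<mu> ?e)"] \<mu>0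
    by (intro mult_left_mono) (simp_all add: norm_mult)
  also have "\<dots> = ?k * ?p ?e"
    by (simp add: right_diff_distrib mult.assoc flip: exp_add)
  finally have n2: "norm (1 - exp (- z * of_real (\<mu> ?e))) \<le> ?k * ?p ?e" .
  \<comment> \<open>The edge contains \<open>x\<close>, which is already in the cluster. It
    therefore touches the cluster in either case, and adding it to the sum produces exactly the
    factor \<open>?k\<close>.\<close>
  have scale: "?k * ?R U A' = bexp ?p U (\<lambda>X. ?w (insert ?e U) (reach X A'))" if "x \<in> A'" for A'
  proof -
    have "?k * ?w U (reach X A') = ?w (insert ?e U) (reach X A')" for X
    proof -
      have "x \<in> reach X A'" by (rule subsetD[OF subset_reach that])
      then have "{e\<in>insert ?e U. e \<inter> reach X A' \<noteq> {}} = insert ?e {e\<in>U. e \<inter> reach X A' \<noteq> {}}"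
        by auto
      then have "sum \<mu> {e\<in>insert ?e U. e \<inter> reach X A' \<noteq> {}} = \<mu> ?e + sum \<mu> {e\<in>U. e \<inter> reach X A' \<noteq> {}}"
        using step.hyps by simp
      then show ?thesis by (simp add: distrib_left exp_add mult_ac)
    qed
    then show ?thesis by (subst bexp_cmult[symmetric]) (intro bexp_cong)
  qed
  have "norm (exp (- z * of_real (\<mu> ?e)) * ?B A + (1 - exp (- z * of_real (\<mu> ?e))) * ?B (insert y A))
    \<le> norm (exp (- z * of_real (\<mu> ?e))) * norm (?B A) +
       norm (1 - exp (- z * of_real (\<mu> ?e))) * norm (?B (insert y A))"
    by (rule order_trans[OF norm_triangle_ineq]) (simp only: norm_mult order_refl)
  also have "\<dots> \<le> (?k * exp (- norm z * \<mu> ?e)) * ?R U A + (?k * ?p ?e) * ?R U (insert y A)"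
    using n1 n2 IH \<mu>0 by (intro add_mono mult_mono) auto
  also have "\<dots> = (1 - ?p ?e) * (?k * ?R U A) + ?p ?e * (?k * ?R U (insert y A))"
    by (simp add: algebra_simps)
  also have "\<dots> = ?R (insert ?e U) A"
    unfolding scale[OF \<open>x \<in> A\<close>] scale[OF insertI2[OF \<open>x \<in> A\<close>]]
    by (rule bexp_reach_step[symmetric]) (use step.hyps in auto)
  finally show ?case
    using bexp_reach_step[of U x y A "\<lambda>e. 1 - exp (- z * of_real (\<mu> e))" "\<lambda>C. of_real (f C)"] step.hyps
    by simp
qed

section \<open>Percolation on finitely many edges\<close>

locale long_range =
  fixes V :: "'v set" and \<mu> :: "'v set \<Rightarrow> real"
  assumes model: "long_range_model V \<mu>"
begin

definition edge_prob :: "real \<Rightarrow> 'v set \<Rightarrow> real" where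
  "edge_prob t e = 1 - exp (- t * \<mu> e)"

text \<open>Translates Boolean configurations into the edge sets over which \<open>bexp\<close>
  sums.\<close>

definition occ :: "'v set set \<Rightarrow> ('v set \<Rightarrow> bool) \<Rightarrow> 'v set set" where
  "occ U \<omega> = {e\<in>U. \<omega> e}"

text \<open>An exhaustion of the countable edge set by finite sets; infinite-volume quantities are
  obtained as limits along it.\<close>

definition edges_upto :: "nat \<Rightarrow> 'v set set" where
  "edges_upto n = {e\<in>pairs V. to_nat_on (pairs V) e < n}"

lemma mu_nonneg: "e \<in> pairs V \<Longrightarrow> 0 \<le> \<mu> e"
  using model by (simp add: long_range_model_def)

lemma finite_edge: "e \<in> pairs V \<Longrightarrow> finite e"
  by (auto simp: pairs_def intro: card_ge_0_finite)

lemma countable_pairs: "countable (pairs V)"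
proof (rule countable_subset)
  show "pairs V \<subseteq> {e. finite e \<and> e \<subseteq> V}" using finite_edge by (auto simp: pairs_def)
  show "countable {e. finite e \<and> e \<subseteq> V}"
    using model by (intro countable_Collect_finite_subset) (auto simp: long_range_model_def)
qed

lemma edges_upto_subset: "edges_upto n \<subseteq> pairs V"
  by (auto simp: edges_upto_def)

lemma finite_edges_upto: "finite (edges_upto n)"
proof (rule finite_imageD)
  show "finite (to_nat_on (pairs V) ` edges_upto n)"
    by (rule finite_subset[of _ "{..<n}"]) (auto simp: edges_upto_def)
  show "inj_on (to_nat_on (pairs V)) (edges_upto n)"
    using inj_on_to_nat_on[OF countable_pairs] edges_upto_subset by (rule inj_on_subset)
qed

lemma edges_upto_mono: "m \<le> n \<Longrightarrow> edges_upto m \<subseteq> edges_upto n"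
  by (auto simp: edges_upto_def)

lemma UN_edges_upto: "(\<Union>n. edges_upto n) = pairs V"
  by (auto simp: edges_upto_def)

lemma edge_prob_bounds: "e \<in> pairs V \<Longrightarrow> 0 \<le> t \<Longrightarrow> 0 \<le> edge_prob t e \<and> edge_prob t e \<le> 1"
  using mu_nonneg[of e] by (simp add: edge_prob_def)

text \<open>Edges at \<open>x\<close> correspond to their other endpoints, so this is a finite
  partial sum of a nonnegative family with sum 1.\<close>

lemma mu_at_le_1:
  assumes "finite U" "U \<subseteq> pairs V" "x \<in> V"
  shows "sum \<mu> {e\<in>U. x \<in> e} \<le> 1"
proof -
  define F where "F = {y\<in>V - {x}. {x, y} \<in> U}"
  have inj: "inj_on (\<lambda>y. {x, y}) F" by (auto simp: inj_on_def F_def doubleton_eq_iff)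
  have "finite F"
    by (rule finite_imageD[OF _ inj], rule finite_subset[OF _ assms(1)]) (auto simp: F_def)
  have "{e\<in>U. x \<in> e} = (\<lambda>y. {x, y}) ` F"
  proof (intro equalityI subsetI)
    fix e assume e: "e \<in> {e\<in>U. x \<in> e}"
    then have "e \<subseteq> V" "card e = 2" "x \<in> e" using assms(2) by (auto simp: pairs_def)
    then obtain y where "e = {x, y}" "y \<noteq> x"
      unfolding card_2_iff by (auto simp: insert_commute)
    then show "e \<in> (\<lambda>y. {x, y}) ` F" using e \<open>e \<subseteq> V\<close> by (auto simp: F_def)
  qed (auto simp: F_def)
  then have "sum \<mu> {e\<in>U. x \<in> e} = (\<Sum>y\<in>F. \<mu> {x, y})"
    using inj by (simp add: sum.reindex)
  also have "\<dots> \<le> 1"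
  proof (rule finite_sum_le_has_sum)
    show "((\<lambda>y. \<mu> {x, y}) has_sum 1) (V - {x})"
      using model assms(3) by (simp add: long_range_model_def)
    fix y assume "y \<in> V - {x} - F"
    then show "0 \<le> \<mu> {x, y}" using assms(3) by (intro mu_nonneg) (auto simp: pairs_def)
  qed (use \<open>finite F\<close> in \<open>auto simp: F_def\<close>)
  finally show ?thesis .
qed

text \<open>Each vertex contributes weight at most 1, and edges meeting several vertices are only
  overcounted. This turns the exponent of \<open>norm_bexp_complex_le\<close> into a multiple of the
  cluster size.\<close>

lemma mu_touching_le_card:
  assumes "finite U" "U \<subseteq> pairs V" "finite C" "C \<subseteq> V"
  shows "sum \<mu> {e\<in>U. e \<inter> C \<noteq> {}} \<le> card C"
  using assms(3,4)
proof (induction C rule: finite_induct)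
  case (insert x C)
  let ?A = "{e\<in>U. x \<in> e}" and ?B = "{e\<in>U. e \<inter> C \<noteq> {}}"
  have "{e\<in>U. e \<inter> insert x C \<noteq> {}} = ?A \<union> ?B" by auto
  moreover have "sum \<mu> (?A \<union> ?B) + sum \<mu> (?A \<inter> ?B) = sum \<mu> ?A + sum \<mu> ?B"
    using assms(1) by (intro sum.union_inter) auto
  moreover have "0 \<le> sum \<mu> (?A \<inter> ?B)" using assms(2) by (intro sum_nonneg mu_nonneg) auto
  ultimately show ?case using insert mu_at_le_1[OF assms(1,2), of x] by simp
qed simp

lemma reach_subset_V: "X \<subseteq> pairs V \<Longrightarrow> x \<in> V \<Longrightarrow> reach X {x} \<subseteq> V"
  by (rule reach_least) (auto simp: pairs_def)

section \<open>The law of finitely many edges\<close>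

lemma product_prob_space_bernoulli:
  "product_prob_space (\<lambda>e. measure_pmf (bernoulli_pmf (1 - exp (- t * \<mu> e))))"
  by unfold_locales

lemma prob_space_percolation: "prob_space (percolation V \<mu> t)"
  unfolding percolation_def by (intro prob_space_PiM measure_pmf.prob_space_axioms)

text \<open>Prescribing the states of the edges in \<open>U\<close> is a cylinder event;
  \<open>{e \<in> X}\<close> is the singleton containing the prescribed truth value.\<close>

lemma occ_eq_emb:
  assumes "U \<subseteq> pairs V" "X \<subseteq> U"
  shows "occ U -` {X} \<inter> space (percolation V \<mu> t) =
    prod_emb (pairs V) (\<lambda>e. measure_pmf (bernoulli_pmf (1 - exp (- t * \<mu> e)))) U
      (\<Pi>\<^sub>E e\<in>U. {e \<in> X})"
proof (intro equalityI subsetI)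
  fix \<omega> assume "\<omega> \<in> occ U -` {X} \<inter> space (percolation V \<mu> t)"
  then show "\<omega> \<in> prod_emb (pairs V) (\<lambda>e. measure_pmf (bernoulli_pmf (1 - exp (- t * \<mu> e)))) U
      (\<Pi>\<^sub>E e\<in>U. {e \<in> X})"
    by (auto simp: prod_emb_def space_PiM percolation_def occ_def)
next
  fix \<omega> assume \<omega>: "\<omega> \<in> prod_emb (pairs V) (\<lambda>e. measure_pmf (bernoulli_pmf (1 - exp (- t * \<mu> e)))) U
      (\<Pi>\<^sub>E e\<in>U. {e \<in> X})"
  then have "\<omega> e \<longleftrightarrow> e \<in> X" if "e \<in> U" for e
    using that by (force simp: prod_emb_def PiE_iff restrict_def)
  then have "occ U \<omega> = X" using assms by (auto simp: occ_def)
  then show "\<omega> \<in> occ U -` {X} \<inter> space (percolation V \<mu> t)"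
    using \<omega> by (auto simp: prod_emb_def space_PiM percolation_def)
qed

lemma measurable_occ:
  assumes "finite U" "U \<subseteq> pairs V"
  shows "occ U \<in> percolation V \<mu> t \<rightarrow>\<^sub>M count_space (Pow U)"
proof (subst measurable_count_space_eq2)
  have "occ U -` {X} \<inter> space (percolation V \<mu> t) \<in> sets (percolation V \<mu> t)" if "X \<subseteq> U" for X
    unfolding occ_eq_emb[OF assms(2) that] unfolding percolation_def
    using assms by (intro sets_PiM_I) auto
  then show "occ U \<in> space (percolation V \<mu> t) \<rightarrow> Pow U \<and>
      (\<forall>a\<in>Pow U. occ U -` {a} \<inter> space (percolation V \<mu> t) \<in> sets (percolation V \<mu> t))"
    by (auto simp: occ_def)
qed (use assms in auto)

lemma measurable_occ_fun:
  assumes "finite U" "U \<subseteq> pairs V"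
  shows "(\<lambda>\<omega>. F (occ U \<omega>)) \<in> percolation V \<mu> t \<rightarrow>\<^sub>M count_space UNIV"
  by (rule measurable_compose[OF measurable_occ[OF assms]]) simp

lemma prob_occ:
  assumes "finite U" "U \<subseteq> pairs V" "X \<subseteq> U" "0 \<le> t"
  shows "measure (percolation V \<mu> t) (occ U -` {X} \<inter> space (percolation V \<mu> t)) =
    (\<Prod>e\<in>X. edge_prob t e) * (\<Prod>e\<in>U - X. 1 - edge_prob t e)"
proof -
  interpret product_prob_space "\<lambda>e. measure_pmf (bernoulli_pmf (1 - exp (- t * \<mu> e)))" "pairs V"
    by (rule product_prob_space_bernoulli)
  have "measure (percolation V \<mu> t) (occ U -` {X} \<inter> space (percolation V \<mu> t)) =
      (\<Prod>e\<in>U. measure (bernoulli_pmf (1 - exp (- t * \<mu> e))) {e \<in> X})"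
    unfolding occ_eq_emb[OF assms(2,3)] unfolding percolation_def
    using assms by (intro measure_PiM_emb) auto
  also have "\<dots> = (\<Prod>e\<in>U. if e \<in> X then edge_prob t e else 1 - edge_prob t e)"
  proof (intro prod.cong refl)
    fix e assume "e \<in> U"
    then have "0 \<le> edge_prob t e" "edge_prob t e \<le> 1"
      using edge_prob_bounds[of e t] assms by auto
    then show "measure (bernoulli_pmf (1 - exp (- t * \<mu> e))) {e \<in> X} =
        (if e \<in> X then edge_prob t e else 1 - edge_prob t e)"
      by (simp add: measure_pmf_single edge_prob_def)
  qed
  also have "\<dots> = (\<Prod>e\<in>X. edge_prob t e) * (\<Prod>e\<in>U - X. 1 - edge_prob t e)"
    using assms by (subst prod.subset_diff[of X U]) (auto simp: mult.commute)
  finally show ?thesis .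
qed

text \<open>A function of the edges in \<open>U\<close> takes finitely many values, so its integral
  is the finite sum \<open>bexp\<close>. This is the bridge between the product measure and the
  combinatorial estimates.\<close>

lemma expectation_occ:
  fixes F :: "'v set set \<Rightarrow> real"
  assumes "finite U" "U \<subseteq> pairs V" "0 \<le> t"
  shows "integrable (percolation V \<mu> t) (\<lambda>\<omega>. F (occ U \<omega>))"
    and "(\<integral>\<omega>. F (occ U \<omega>) \<partial>percolation V \<mu> t) = bexp (edge_prob t) U F"
proof -
  interpret P: prob_space "percolation V \<mu> t" by (rule prob_space_percolation)
  let ?A = "\<lambda>X. occ U -` {X} \<inter> space (percolation V \<mu> t)"
  have sets: "?A X \<in> sets (percolation V \<mu> t)" if "X \<in> Pow U" for X
    using measurable_occ[OF assms(1,2)] that by (intro measurable_sets) auto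
  have eq: "F (occ U \<omega>) = (\<Sum>X\<in>Pow U. F X * indicator (?A X) \<omega>)"
    if "\<omega> \<in> space (percolation V \<mu> t)" for \<omega>
  proof -
    have "(\<Sum>X\<in>Pow U. F X * indicator (?A X) \<omega>) =
        (\<Sum>X\<in>Pow U. if X = occ U \<omega> then F X else 0)"
      using that by (intro sum.cong) (auto simp: indicator_def)
    also have "\<dots> = F (occ U \<omega>)"
      using assms(1) by (subst sum.delta) (auto simp: occ_def)
    finally show ?thesis by simp
  qed
  have int: "integrable (percolation V \<mu> t) (\<lambda>\<omega>. F X * indicator (?A X) \<omega>)" if "X \<in> Pow U" for X
    using sets[OF that] by (intro integrable_mult_right integrable_real_indicator) (auto simp: P.emeasure_eq_measure)
  show "integrable (percolation V \<mu> t) (\<lambda>\<omega>. F (occ U \<omega>))"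
    using int by (subst Bochner_Integration.integrable_cong[OF refl eq]) auto
  have "(\<integral>\<omega>. F (occ U \<omega>) \<partial>percolation V \<mu> t) =
      (\<integral>\<omega>. (\<Sum>X\<in>Pow U. F X * indicator (?A X) \<omega>) \<partial>percolation V \<mu> t)"
    using eq by (intro Bochner_Integration.integral_cong) auto
  also have "\<dots> = (\<Sum>X\<in>Pow U. F X * measure (percolation V \<mu> t) (?A X))"
    using int sets by (subst Bochner_Integration.integral_sum) (auto simp: Int_absorb2 intro!: sum.cong)
  also have "\<dots> = bexp (edge_prob t) U F"
    unfolding bexp_def using prob_occ[OF assms(1,2) _ assms(3)] by (intro sum.cong) (auto simp: mult_ac)
  finally show "(\<integral>\<omega>. F (occ U \<omega>) \<partial>percolation V \<mu> t) = bexp (edge_prob t) U F" .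
qed

lemma prob_occ_pred:
  assumes "finite U" "U \<subseteq> pairs V" "0 \<le> t"
  shows "{\<omega> \<in> space (percolation V \<mu> t). Q (occ U \<omega>)} \<in> sets (percolation V \<mu> t)"
    and "\<P>(\<omega> in percolation V \<mu> t. Q (occ U \<omega>)) = bexp (edge_prob t) U (\<lambda>X. of_bool (Q X))"
proof -
  interpret P: prob_space "percolation V \<mu> t" by (rule prob_space_percolation)
  show s: "{\<omega> \<in> space (percolation V \<mu> t). Q (occ U \<omega>)} \<in> sets (percolation V \<mu> t)"
    using measurable_occ_fun[OF assms(1,2), of Q] by (rule pred_def[THEN iffD1])
  have "\<P>(\<omega> in percolation V \<mu> t. Q (occ U \<omega>)) =
      (\<integral>\<omega>. indicator {\<omega> \<in> space (percolation V \<mu> t). Q (occ U \<omega>)} \<omega> \<partial>percolation V \<mu> t)"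
    using s by (simp add: Int_absorb2)
  also have "\<dots> = (\<integral>\<omega>. of_bool (Q (occ U \<omega>)) \<partial>percolation V \<mu> t)"
    by (intro Bochner_Integration.integral_cong) (auto simp: indicator_def)
  also have "\<dots> = bexp (edge_prob t) U (\<lambda>X. of_bool (Q X))"
    by (rule expectation_occ(2)[OF assms])
  finally show "\<P>(\<omega> in percolation V \<mu> t. Q (occ U \<omega>)) = bexp (edge_prob t) U (\<lambda>X. of_bool (Q X))" .
qed

section \<open>The cluster as an increasing limit\<close>

lemma cluster_eq_reach: "cluster V \<omega> x = reach (occ (pairs V) \<omega>) {x}"
  by (auto simp: cluster_def reach_def occ_def)

lemma occ_mono: "U \<subseteq> W \<Longrightarrow> occ U \<omega> \<subseteq> occ W \<omega>"
  by (auto simp: occ_def)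

lemma finite_reach_occ: "finite U \<Longrightarrow> U \<subseteq> pairs V \<Longrightarrow> finite (reach (occ U \<omega>) {x})"
  by (rule finite_reach) (auto simp: occ_def intro: finite_edge)

lemma cluster_eq_UN: "cluster V \<omega> x = (\<Union>n. reach (occ (edges_upto n) \<omega>) {x})"
proof
  show "cluster V \<omega> x \<subseteq> (\<Union>n. reach (occ (edges_upto n) \<omega>) {x})"
    unfolding cluster_eq_reach
  proof (rule reach_least)
    show "{x} \<subseteq> (\<Union>n. reach (occ (edges_upto n) \<omega>) {x})"
      using subset_reach[of "{x}"] by auto
    fix y z assume y: "y \<in> (\<Union>n. reach (occ (edges_upto n) \<omega>) {x})" and "{y, z} \<in> occ (pairs V) \<omega>"
    then have "{y, z} \<in> (\<Union>n. edges_upto n)" "\<omega> {y, z}"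
      unfolding UN_edges_upto by (auto simp: occ_def)
    \<comment> \<open>The path to \<open>y\<close> and the edge to \<open>z\<close> may appear at
      different stages; both are present at the larger one.\<close>
    then obtain n m where "y \<in> reach (occ (edges_upto n) \<omega>) {x}" "{y, z} \<in> occ (edges_upto m) \<omega>"
      using y by (auto simp: occ_def)
    then have "y \<in> reach (occ (edges_upto (max n m)) \<omega>) {x}"
      by (intro subsetD[OF reach_mono[OF occ_mono[OF edges_upto_mono[OF max.cobounded1]] order_refl]])
    moreover have "{y, z} \<in> occ (edges_upto (max n m)) \<omega>"
      using \<open>{y, z} \<in> occ (edges_upto m) \<omega>\<close>
      by (rule subsetD[OF occ_mono[OF edges_upto_mono[OF max.cobounded2]]])
    ultimately show "z \<in> (\<Union>n. reach (occ (edges_upto n) \<omega>) {x})"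
      using reach_step by fast
  qed
  show "(\<Union>n. reach (occ (edges_upto n) \<omega>) {x}) \<subseteq> cluster V \<omega> x"
    unfolding cluster_eq_reach by (intro UN_least reach_mono occ_mono edges_upto_subset) auto
qed

lemma incseq_card_reach_upto: "incseq (\<lambda>n. card (reach (occ (edges_upto n) \<omega>) {x}))"
  by (intro incseq_SucI card_mono finite_reach_occ finite_edges_upto edges_upto_subset reach_mono
      occ_mono edges_upto_mono) auto

text \<open>Continuity from below of the counting measure.\<close>

lemma cluster_size_eq_SUP:
  "cluster_size V \<omega> x = (SUP n. of_nat (card (reach (occ (edges_upto n) \<omega>) {x})))"
proof -
  have "cluster_size V \<omega> x =
      (SUP n. emeasure (count_space UNIV) (reach (occ (edges_upto n) \<omega>) {x}))"
    unfolding cluster_size_def cluster_eq_UN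
    by (intro SUP_emeasure_incseq[symmetric] incseq_SucI reach_mono occ_mono edges_upto_mono) auto
  then show ?thesis
    by (simp add: emeasure_count_space_finite finite_reach_occ finite_edges_upto edges_upto_subset)
qed

lemma card_reach_le_cluster_size:
  assumes "finite U" "U \<subseteq> pairs V"
  shows "of_nat (card (reach (occ U \<omega>) {x})) \<le> cluster_size V \<omega> x"
proof -
  have "of_nat (card (reach (occ U \<omega>) {x})) = emeasure (count_space UNIV) (reach (occ U \<omega>) {x})"
    using assms by (simp add: emeasure_count_space_finite finite_reach_occ)
  also have "\<dots> \<le> cluster_size V \<omega> x"
    unfolding cluster_size_def cluster_eq_reach
    using assms by (intro emeasure_mono reach_mono occ_mono) auto
  finally show ?thesis .
qed

lemma le_cluster_size_iff:
  "of_nat n \<le> cluster_size V \<omega> x \<longleftrightarrow> (\<exists>k. n \<le> card (reach (occ (edges_upto k) \<omega>) {x}))"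
proof
  assume *: "of_nat n \<le> cluster_size V \<omega> x"
  show "\<exists>k. n \<le> card (reach (occ (edges_upto k) \<omega>) {x})"
  proof (rule ccontr)
    assume neg: "\<not> ?thesis"
    \<comment> \<open>For \<open>n = 0\<close> every \<open>k\<close> would do. Excluding it
      matters, as \<open>n - 1\<close> is truncated subtraction and must lie strictly below
      \<open>n\<close>.\<close>
    then have n: "n \<noteq> 0" by auto
    have "cluster_size V \<omega> x \<le> of_nat (n - 1)"
      unfolding cluster_size_eq_SUP
    proof (rule SUP_least)
      fix k
      have "card (reach (occ (edges_upto k) \<omega>) {x}) \<le> n - 1"
        using neg[unfolded not_ex, rule_format, of k] by linarith
      then show "of_nat (card (reach (occ (edges_upto k) \<omega>) {x})) \<le> (of_nat (n - 1) :: ennreal)"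
        by (rule of_nat_mono)
    qed
    with * have "(of_nat n :: ennreal) \<le> of_nat (n - 1)" by (rule order_trans)
    then show False using n by (simp add: ennreal_of_nat_eq_real_of_nat)
  qed
next
  assume "\<exists>k. n \<le> card (reach (occ (edges_upto k) \<omega>) {x})"
  then obtain k where "n \<le> card (reach (occ (edges_upto k) \<omega>) {x})" ..
  then have "(of_nat n :: ennreal) \<le> of_nat (card (reach (occ (edges_upto k) \<omega>) {x}))"
    by (rule of_nat_mono)
  also have "\<dots> \<le> cluster_size V \<omega> x"
    by (intro card_reach_le_cluster_size finite_edges_upto edges_upto_subset)
  finally show "of_nat n \<le> cluster_size V \<omega> x" .
qed

lemma borel_measurable_card_reach:
  "(\<lambda>\<omega>. of_nat (card (reach (occ (edges_upto n) \<omega>) {x})) :: ennreal) \<in> borel_measurable (percolation V \<mu> t)"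
  by (rule measurable_compose[OF measurable_occ_fun[OF finite_edges_upto edges_upto_subset,
      where F = "\<lambda>X. X"]]) simp

lemma measurable_cluster_size [measurable]:
  "(\<lambda>\<omega>. cluster_size V \<omega> x) \<in> borel_measurable (percolation V \<mu> t)"
  unfolding cluster_size_eq_SUP by (intro borel_measurable_SUP borel_measurable_card_reach) auto

lemma bexp_tail_le:
  assumes "finite U" "U \<subseteq> pairs V" "0 \<le> t"
  shows "bexp (edge_prob t) U (\<lambda>X. of_bool (n \<le> card (reach X {x})))
    \<le> \<P>(\<omega> in percolation V \<mu> t. of_nat n \<le> cluster_size V \<omega> x)"
proof -
  interpret P: prob_space "percolation V \<mu> t" by (rule prob_space_percolation)
  have "\<P>(\<omega> in percolation V \<mu> t. n \<le> card (reach (occ U \<omega>) {x}))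
      \<le> \<P>(\<omega> in percolation V \<mu> t. of_nat n \<le> cluster_size V \<omega> x)"
  proof (rule P.finite_measure_mono)
    have "of_nat n \<le> cluster_size V \<omega> x" if "n \<le> card (reach (occ U \<omega>) {x})" for \<omega>
      using order_trans[OF of_nat_mono[OF that] card_reach_le_cluster_size[OF assms(1,2)]] .
    then show "{\<omega> \<in> space (percolation V \<mu> t). n \<le> card (reach (occ U \<omega>) {x})} \<subseteq>
        {\<omega> \<in> space (percolation V \<mu> t). of_nat n \<le> cluster_size V \<omega> x}" by auto
  qed measurable
  then show ?thesis
    using prob_occ_pred(2)[OF assms, of "\<lambda>X. n \<le> card (reach X {x})"] by simp
qed

lemma bexp_tail_tendsto:
  assumes "0 \<le> t"
  shows "(\<lambda>k. bexp (edge_prob t) (edges_upto k) (\<lambda>X. of_bool (n \<le> card (reach X {x}))))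
    \<longlonglongrightarrow> \<P>(\<omega> in percolation V \<mu> t. of_nat n \<le> cluster_size V \<omega> x)"
proof -
  interpret P: prob_space "percolation V \<mu> t" by (rule prob_space_percolation)
  let ?A = "\<lambda>k. {\<omega> \<in> space (percolation V \<mu> t). n \<le> card (reach (occ (edges_upto k) \<omega>) {x})}"
  have "(\<lambda>k. measure (percolation V \<mu> t) (?A k)) \<longlonglongrightarrow> measure (percolation V \<mu> t) (\<Union>k. ?A k)"
  proof (rule P.finite_Lim_measure_incseq)
    show "range ?A \<subseteq> sets (percolation V \<mu> t)"
      using prob_occ_pred(1)[OF finite_edges_upto edges_upto_subset assms] by auto
    show "incseq ?A"
      using incseq_card_reach_upto by (intro incseq_SucI) (force simp: incseq_Suc_iff intro: order_trans)
  qed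
  also have "(\<Union>k. ?A k) = {\<omega> \<in> space (percolation V \<mu> t). of_nat n \<le> cluster_size V \<omega> x}"
    by (auto simp: le_cluster_size_iff)
  finally show ?thesis
    using prob_occ_pred(2)[OF finite_edges_upto edges_upto_subset assms,
        where Q = "\<lambda>X. n \<le> card (reach X {x})"] by simp
qed

section \<open>Analyticity\<close>

text \<open>Monotone convergence along the exhaustion. The values stay in \<open>ennreal\<close>, so
  an infinite limit is allowed.\<close>

lemma susceptibility_tendsto:
  assumes "0 \<le> t"
  shows "(\<lambda>k. ennreal (bexp (edge_prob t) (edges_upto k) (\<lambda>X. card (reach X {x}))))
    \<longlonglongrightarrow> susceptibility V \<mu> x t"
proof -
  let ?f = "\<lambda>k \<omega>. of_nat (card (reach (occ (edges_upto k) \<omega>) {x})) :: ennreal"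
  let ?b = "\<lambda>k. ennreal (bexp (edge_prob t) (edges_upto k) (\<lambda>X. card (reach X {x})))"
  have f: "(\<integral>\<^sup>+ \<omega>. ?f k \<omega> \<partial>percolation V \<mu> t) = ?b k" for k
    using expectation_occ[OF finite_edges_upto edges_upto_subset assms, of "\<lambda>X. card (reach X {x})"]
    by (simp add: ennreal_of_nat_eq_real_of_nat nn_integral_eq_integral)
  have inc: "incseq ?f"
    using incseq_card_reach_upto by (auto simp: incseq_def le_fun_def intro!: of_nat_mono)
  have "susceptibility V \<mu> x t = (\<integral>\<^sup>+ \<omega>. (SUP k. ?f k \<omega>) \<partial>percolation V \<mu> t)"
    by (simp add: susceptibility_def cluster_size_eq_SUP)
  also have "\<dots> = (SUP k. \<integral>\<^sup>+ \<omega>. ?f k \<omega> \<partial>percolation V \<mu> t)"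
    by (intro nn_integral_monotone_convergence_SUP inc borel_measurable_card_reach)
  also have "\<dots> = (SUP k. ?b k)" by (simp add: f)
  finally show ?thesis
    using inc unfolding f[symmetric]
    by (auto simp: incseq_def le_fun_def intro!: LIMSEQ_SUP nn_integral_mono)
qed

text \<open>Half of the decay rate pays for the exponential weight and the other half makes the
  series converge. The essential point is that \<open>B\<close> does not depend on
  \<open>U\<close>.\<close>

lemma exponential_moment_bound:
  assumes "0 \<le> t" "0 < c"
    and "\<forall>\<^sub>F n in sequentially.
      \<P>(\<omega> in percolation V \<mu> t. of_nat n \<le> cluster_size V \<omega> x) \<le> exp (- c * real n)"
  obtains B where "\<And>U. finite U \<Longrightarrow> U \<subseteq> pairs V \<Longrightarrow>
    bexp (edge_prob t) U (\<lambda>X. card (reach X {x}) * exp (c / 2 * card (reach X {x}))) \<le> B"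
proof -
  interpret P: prob_space "percolation V \<mu> t" by (rule prob_space_percolation)
  let ?P = "\<lambda>n. \<P>(\<omega> in percolation V \<mu> t. of_nat n \<le> cluster_size V \<omega> x)"
  obtain n0 where n0: "\<And>n. n0 \<le> n \<Longrightarrow> ?P n \<le> exp (- c * real n)"
    using assms(3) by (auto simp: eventually_sequentially)
  \<comment> \<open>The factor \<open>M\<close> extends the tail bound to all \<open>n\<close>: for
    \<open>n < n0\<close> the right side is at least 1.\<close>
  define M where "M = exp (c * n0)"
  have M: "?P n \<le> M * exp (- c * n)" for n
  proof (cases "n0 \<le> n")
    case True
    have "exp (- c * n) \<le> M * exp (- c * n)" using assms(2) by (simp add: M_def)
    with n0[OF True] show ?thesis by linarith
  next
    case False
    have "?P n \<le> 1" by (rule P.prob_le_1)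
    also have "\<dots> \<le> M * exp (- c * n)"
      using False assms(2) by (simp add: M_def flip: exp_add)
    finally show ?thesis .
  qed
  define q where "q = exp (- (c / 2))"
  have q: "0 \<le> q" "q < 1" using assms(2) by (auto simp: q_def)
  let ?g = "\<lambda>n::nat. n * exp (c / 2 * n)"
  \<comment> \<open>Passing from \<open>n\<close> to \<open>Suc n\<close> gives the differentiated
    geometric series, whose convergence is known.\<close>
  have gM: "?g n * (M * exp (- c * n)) \<le> M * (Suc n * q ^ n)" for n
  proof -
    have "exp (c / 2 * n) * exp (- c * n) = q ^ n"
      by (simp add: q_def flip: exp_add exp_of_nat_mult)
    then have "?g n * (M * exp (- c * n)) = M * (n * q ^ n)"
      by (simp add: mult_ac)
    also have "\<dots> \<le> M * (Suc n * q ^ n)"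
      using q by (intro mult_left_mono mult_right_mono) (auto simp: M_def)
    finally show ?thesis .
  qed
  have summ: "summable (\<lambda>n. M * (Suc n * q ^ n))"
    using geometric_deriv_sums[of q] q by (intro summable_mult) (auto simp: sums_iff)
  show ?thesis
  proof (rule that[of "\<Sum>n. M * (Suc n * q ^ n)"])
    fix U assume U: "finite U" "U \<subseteq> pairs V"
    let ?K = "\<lambda>X. card (reach X {x})"
    \<comment> \<open>The value at \<open>?K X\<close> is one term of the sum, so tail probabilities
      suffice. Stopping at \<open>?K U\<close>, the largest possible size, keeps the sum
      finite.\<close>
    have "bexp (edge_prob t) U (\<lambda>X. ?g (?K X))
        \<le> bexp (edge_prob t) U (\<lambda>X. \<Sum>n\<le>?K U. ?g n * of_bool (n \<le> ?K X))"
    proof (rule bexp_mono)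
      fix X assume "X \<subseteq> U"
      then have "?K X \<le> ?K U"
        using U finite_edge by (intro card_reach_mono) auto
      then show "?g (?K X) \<le> (\<Sum>n\<le>?K U. ?g n * of_bool (n \<le> ?K X))"
        using member_le_sum[of "?K X" "{..?K U}" "\<lambda>n. ?g n * of_bool (n \<le> ?K X)"] by auto
    qed (use edge_prob_bounds U assms in auto)
    also have "\<dots> = (\<Sum>n\<le>?K U. ?g n * bexp (edge_prob t) U (\<lambda>X. of_bool (n \<le> ?K X)))"
      by (simp only: bexp_sum bexp_cmult)
    also have "\<dots> \<le> (\<Sum>n\<le>?K U. ?g n * (M * exp (- c * n)))"
      by (intro sum_mono mult_left_mono order_trans[OF bexp_tail_le[OF U assms(1)] M]) auto
    also have "\<dots> \<le> (\<Sum>n\<le>?K U. M * (Suc n * q ^ n))"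
      by (intro sum_mono gM)
    also have "\<dots> \<le> (\<Sum>n. M * (Suc n * q ^ n))"
      using q by (intro sum_le_suminf summ) (auto simp: M_def)
    finally show "bexp (edge_prob t) U (\<lambda>X. ?g (?K X)) \<le> (\<Sum>n. M * (Suc n * q ^ n))" .
  qed
qed

lemma susceptibility_finite:
  fixes d :: real
  assumes "0 \<le> t" "0 \<le> d"
    and B: "\<And>U. finite U \<Longrightarrow> U \<subseteq> pairs V \<Longrightarrow>
      bexp (edge_prob t) U (\<lambda>X. card (reach X {x}) * exp (d * card (reach X {x}))) \<le> B"
  shows "susceptibility V \<mu> x t < \<infinity>"
proof -
  have "bexp (edge_prob t) (edges_upto k) (\<lambda>X. card (reach X {x})) \<le> B" for k
  proof -
    have "bexp (edge_prob t) (edges_upto k) (\<lambda>X. card (reach X {x})) \<le>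
      bexp (edge_prob t) (edges_upto k) (\<lambda>X. card (reach X {x}) * exp (d * card (reach X {x})))"
    proof (rule bexp_mono)
      fix X
      show "real (card (reach X {x})) \<le> card (reach X {x}) * exp (d * card (reach X {x}))"
        using mult_left_mono[of 1 "exp (d * card (reach X {x}))" "card (reach X {x})"] assms(2) by simp
    qed (use edge_prob_bounds edges_upto_subset assms(1) in auto)
    also have "\<dots> \<le> B" by (intro B finite_edges_upto edges_upto_subset)
    finally show ?thesis .
  qed
  then have "susceptibility V \<mu> x t \<le> ennreal B"
    by (intro LIMSEQ_le_const2[OF susceptibility_tendsto[OF assms(1)]]) (auto intro: ennreal_leI)
  then show ?thesis using le_less_trans[OF _ ennreal_less_top] by simp
qed

text \<open>The moment bound is taken at \<open>s > t\<close> to leave room for complex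
  \<open>z\<close> near \<open>t\<close> with \<open>norm z > t\<close>. Finiteness at
  \<open>y\<close> lets \<open>enn2real\<close> pass to the limit.\<close>

lemma susceptibility_holomorphic_extension:
  fixes d :: real
  assumes "0 \<le> t" "t < s" "0 < d" "x \<in> V"
    and B: "\<And>U. finite U \<Longrightarrow> U \<subseteq> pairs V \<Longrightarrow>
      bexp (edge_prob s) U (\<lambda>X. card (reach X {x}) * exp (d * card (reach X {x}))) \<le> B"
  shows "\<exists>r>0. \<exists>F. F holomorphic_on ball (complex_of_real t) r \<and>
    (\<forall>y\<ge>0. complex_of_real y \<in> ball (complex_of_real t) r \<longrightarrow> susceptibility V \<mu> x y < \<infinity> \<longrightarrow>
      F (complex_of_real y) = complex_of_real (enn2real (susceptibility V \<mu> x y)))"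
proof -
  \<comment> \<open>The bound \<open>s - t\<close> gives \<open>norm z \<le> s\<close> on the disc;
    \<open>d / 2\<close> gives \<open>norm z - Re z \<le> 2 * norm (z - t) < d\<close>.\<close>
  define r where "r = min (s - t) (d / 2)"
  let ?D = "ball (complex_of_real t) r"
  let ?K = "\<lambda>X. card (reach X {x})"
  define f :: "nat \<Rightarrow> complex \<Rightarrow> complex" where
    "f = (\<lambda>n z. bexp (\<lambda>e. 1 - exp (- z * of_real (\<mu> e))) (edges_upto n) (\<lambda>X. of_real (?K X)))"
  have hol: "f n holomorphic_on ?D" for n
    unfolding f_def bexp_def by (intro holomorphic_intros)
  have bound: "norm (f n z) \<le> B" if z: "z \<in> ?D" for n z
  proof -
    let ?U = "edges_upto n"
    have U: "finite ?U" "?U \<subseteq> pairs V" by (rule finite_edges_upto, rule edges_upto_subset)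
    have dz: "norm (z - t) < s - t" "norm (z - t) < d / 2"
      using z by (auto simp: r_def dist_norm norm_minus_commute)
    have nz: "norm z \<le> t + norm (z - t)"
      using norm_triangle_ineq[of "z - t" t] assms(1) by simp
    then have zs: "norm z \<le> s" using dz by simp
    have "t - Re z \<le> norm (z - t)"
      using abs_Re_le_cmod[of "z - t"] by simp
    then have \<delta>: "norm z - Re z \<le> d" "0 \<le> norm z - Re z"
      using nz dz complex_Re_le_cmod[of z] by auto
    have "norm (f n z) \<le> bexp (edge_prob (norm z)) ?U
        (\<lambda>X. \<bar>real (?K X)\<bar> * exp ((norm z - Re z) * sum \<mu> {e\<in>?U. e \<inter> reach X {x} \<noteq> {}}))"
      unfolding f_def edge_prob_def
      by (rule norm_bexp_complex_le) (use U mu_nonneg in auto)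
    also have "\<dots> \<le> bexp (edge_prob (norm z)) ?U (\<lambda>X. ?K X * exp (d * ?K X))"
    proof (rule bexp_mono)
      fix X assume X: "X \<subseteq> ?U"
      have "finite (reach X {x})"
        using X U finite_edge by (intro finite_reach) (auto intro: finite_subset)
      then have "sum \<mu> {e\<in>?U. e \<inter> reach X {x} \<noteq> {}} \<le> ?K X"
        using X U assms(4) by (intro mu_touching_le_card reach_subset_V) auto
      then have "(norm z - Re z) * sum \<mu> {e\<in>?U. e \<inter> reach X {x} \<noteq> {}} \<le> d * ?K X"
        using \<delta> U mu_nonneg by (intro mult_mono sum_nonneg) auto
      then show "\<bar>real (?K X)\<bar> * exp ((norm z - Re z) * sum \<mu> {e\<in>?U. e \<inter> reach X {x} \<noteq> {}})
          \<le> ?K X * exp (d * ?K X)"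
        by (intro mult_mono) auto
    qed (use edge_prob_bounds U in auto)
    \<comment> \<open>The integrand increases with the cluster, so the parameter may be raised from
      \<open>norm z\<close> to \<open>s\<close>, where the moment bound holds uniformly in
      \<open>n\<close>.\<close>
    also have "\<dots> \<le> bexp (edge_prob s) ?U (\<lambda>X. ?K X * exp (d * ?K X))"
    proof (rule bexp_mono_prob)
      fix e assume "e \<in> ?U"
      then have "e \<in> pairs V" using U by auto
      then show "0 \<le> edge_prob (norm z) e \<and> edge_prob (norm z) e \<le> edge_prob s e \<and> edge_prob s e \<le> 1"
        using edge_prob_bounds[of e "norm z"] edge_prob_bounds[of e s] zs mu_nonneg[of e] assms(1,2)
        by (auto simp: edge_prob_def mult_right_mono)
    next
      fix X Y assume "X \<subseteq> Y" "Y \<subseteq> ?U"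
      then have "?K X \<le> ?K Y"
        using U finite_edge by (intro card_reach_mono) (auto intro: finite_subset)
      then show "?K X * exp (d * ?K X) \<le> ?K Y * exp (d * ?K Y)"
        using assms(3) by (intro mult_mono) auto
    qed (use U in auto)
    also have "\<dots> \<le> B" by (rule B[OF U])
    finally show ?thesis .
  qed
  obtain F \<rho> where F: "F holomorphic_on ?D" "strict_mono (\<rho> :: nat \<Rightarrow> nat)"
      "\<And>z. z \<in> ?D \<Longrightarrow> (\<lambda>n. f (\<rho> n) z) \<longlonglongrightarrow> F z"
  proof (rule Montel[of ?D "range f" f])
    show "\<exists>B. \<forall>h\<in>range f. \<forall>z\<in>K. norm (h z) \<le> B" if "compact K" "K \<subseteq> ?D" for K
      using bound that by (intro exI[of _ B]) auto
  qed (use hol in auto)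
  show ?thesis
  proof (intro exI[of _ r] exI[of _ F] conjI allI impI)
    show "0 < r" using assms by (simp add: r_def)
    show "F holomorphic_on ?D" by (rule F)
    fix y :: real assume y: "0 \<le> y" "complex_of_real y \<in> ?D" "susceptibility V \<mu> x y < \<infinity>"
    let ?b = "\<lambda>k. bexp (edge_prob y) (edges_upto k) (\<lambda>X. ?K X)"
    have b0: "0 \<le> ?b k" for k
      unfolding bexp_def using edge_prob_bounds[OF _ y(1)] edges_upto_subset[of k]
      by (intro sum_nonneg mult_nonneg_nonneg prod_nonneg) auto
    have "(\<lambda>k. enn2real (ennreal (?b k))) \<longlonglongrightarrow> enn2real (susceptibility V \<mu> x y)"
      using y(3) susceptibility_tendsto[OF y(1), of x] by (intro tendsto_enn2real) auto
    then have "?b \<longlonglongrightarrow> enn2real (susceptibility V \<mu> x y)"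
      using b0 by simp
    \<comment> \<open>On the real points of the disc with \<open>y \<ge> 0\<close> the whole
      sequence converges to the susceptibility, so the subsequence chosen by Montel's theorem has
      the same limit.\<close>
    then have "(\<lambda>k. complex_of_real (?b (\<rho> k))) \<longlonglongrightarrow> complex_of_real (enn2real (susceptibility V \<mu> x y))"
      using F(2) by (intro tendsto_of_real) (rule LIMSEQ_subseq_LIMSEQ[unfolded comp_def])
    moreover have "complex_of_real (?b k) = f k y" for k
      unfolding f_def bexp_of_real[symmetric] edge_prob_def
      by (simp add: exp_of_real[symmetric])
    ultimately show "F y = complex_of_real (enn2real (susceptibility V \<mu> x y))"
      using F(3)[OF y(2)] LIMSEQ_unique by auto
  qed
qed

section \<open>Sharpness\<close>

text \<open>An automorphism moving \<open>x\<close> to \<open>v\<close> preserves the law and maps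
  the cluster of \<open>x\<close> in the relabelled configuration into the cluster of
  \<open>v\<close>.\<close>

lemma transitive_tail_le:
  assumes "transitive_model V \<mu>" "x \<in> V" "v \<in> V"
  shows "\<P>(\<omega> in percolation V \<mu> t. of_nat n \<le> cluster_size V \<omega> x)
    \<le> \<P>(\<omega> in percolation V \<mu> t. of_nat n \<le> cluster_size V \<omega> v)"
proof -
  interpret P: prob_space "percolation V \<mu> t" by (rule prob_space_percolation)
  obtain G :: "('v \<Rightarrow> 'v) monoid" and \<phi> where act: "transitive_action G V \<phi>"
    and inv: "\<And>g e. g \<in> carrier G \<Longrightarrow> e \<in> pairs V \<Longrightarrow> \<mu> (\<phi> g ` e) = \<mu> e"
    using assms(1) by (auto simp: transitive_model_def)
  interpret transitive_action G V \<phi> by (rule act)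
  obtain g where g: "g \<in> carrier G" "\<phi> g x = v" using unique_orbit assms by blast
  define f where "f = \<phi> g"
  have f: "inj_on f V" "f ` V = V"
    using bij_prop0[OF g(1)] by (auto simp: Bij_def bij_betw_def f_def)
  have f_pairs: "f ` e \<in> pairs V" if "e \<in> pairs V" for e
    using that f by (auto simp: pairs_def card_image inj_on_subset)
  have f_inj: "inj_on ((`) f) (pairs V)"
    by (rule inj_on_subset[OF inj_on_image_Pow[OF f(1)]]) (auto simp: pairs_def)
  let ?M = "\<lambda>e. measure_pmf (bernoulli_pmf (1 - exp (- t * \<mu> e)))"
  \<comment> \<open>Pulls a configuration back along \<open>f\<close>. Injectivity on edges keeps
    the states independent, and invariance of \<open>\<mu>\<close> keeps their
    probabilities.\<close>
  let ?T = "\<lambda>\<omega>. \<lambda>e\<in>pairs V. \<omega> (f ` e)"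
  have PiM: "PiM (pairs V) (\<lambda>e. ?M (f ` e)) = percolation V \<mu> t"
    unfolding percolation_def using inv[OF g(1)] by (intro PiM_cong) (auto simp: f_def)
  have "distr (PiM (pairs V) ?M) (PiM (pairs V) (\<lambda>e. ?M (f ` e))) ?T = PiM (pairs V) (\<lambda>e. ?M (f ` e))"
    using f_pairs f_inj by (intro distr_PiM_reindex) (auto intro: measure_pmf.prob_space_axioms)
  then have distr: "distr (percolation V \<mu> t) (percolation V \<mu> t) ?T = percolation V \<mu> t"
    unfolding PiM by (simp add: percolation_def)
  have T [measurable]: "?T \<in> percolation V \<mu> t \<rightarrow>\<^sub>M percolation V \<mu> t"
    unfolding percolation_def
    by (rule measurable_restrict) (use f_pairs in \<open>auto intro!: measurable_compose[OF measurable_component_singleton]\<close>)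
  have le: "cluster_size V (?T \<omega>) x \<le> cluster_size V \<omega> v" for \<omega>
  proof -
    have sub: "cluster V (?T \<omega>) x \<subseteq> V \<inter> f -` cluster V \<omega> v"
      unfolding cluster_eq_reach
    proof (rule reach_least)
      show "{x} \<subseteq> V \<inter> f -` reach (occ (pairs V) \<omega>) {v}"
        using assms g subset_reach[of "{v}"] by (auto simp: f_def)
      fix y z assume yz: "y \<in> V \<inter> f -` reach (occ (pairs V) \<omega>) {v}" "{y, z} \<in> occ (pairs V) (?T \<omega>)"
      then have "{f y, f z} \<in> occ (pairs V) \<omega>"
        using f_pairs[of "{y, z}"] by (auto simp: occ_def)
      then show "z \<in> V \<inter> f -` reach (occ (pairs V) \<omega>) {v}"
        using yz reach_step by (force simp: occ_def pairs_def)
    qed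
    then have inj: "inj_on f (cluster V (?T \<omega>) x)" using f(1) by (auto intro: inj_on_subset)
    show ?thesis
    proof (cases "finite (cluster V \<omega> v)")
      case True
      have im: "f ` cluster V (?T \<omega>) x \<subseteq> cluster V \<omega> v" using sub by auto
      then have "finite (cluster V (?T \<omega>) x)"
        using True inj finite_imageD finite_subset by blast
      moreover have "card (cluster V (?T \<omega>) x) \<le> card (cluster V \<omega> v)"
        using True inj im by (rule card_inj_on_le[rotated 2])
      ultimately show ?thesis
        using True by (simp add: cluster_size_def emeasure_count_space_finite of_nat_mono)
    qed (simp add: cluster_size_def emeasure_count_space_infinite)
  qed
  let ?S = "{\<omega> \<in> space (percolation V \<mu> t). of_nat n \<le> cluster_size V \<omega> x}"
  have "measure (percolation V \<mu> t) ?S = measure (distr (percolation V \<mu> t) (percolation V \<mu> t) ?T) ?S"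
    by (simp only: distr)
  also have "\<dots> = measure (percolation V \<mu> t) (?T -` ?S \<inter> space (percolation V \<mu> t))"
    by (rule measure_distr[OF T]) measurable
  also have "\<dots> \<le> \<P>(\<omega> in percolation V \<mu> t. of_nat n \<le> cluster_size V \<omega> v)"
    using le by (intro P.finite_measure_mono) (auto intro: order_trans)
  finally show ?thesis .
qed

text \<open>Supplies the relative gap required by \<open>tilted_domination\<close>, uniformly over
  all edges. The difference of the two probabilities is
  \<open>exp (- t * a) * (1 - exp (- (s - t) * a))\<close>; the first factor is bounded using
  \<open>a \<le> 1\<close>, the second by convexity.\<close>

lemma edge_prob_gap:
  assumes "0 \<le> t" "t < s" "e \<in> pairs V"
  shows "edge_prob t e \<le> (1 - exp (- t) * ((s - t) / s)) * edge_prob s e"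
proof -
  define a where "a = \<mu> e"
  define l where "l = (s - t) / s"
  have "e \<noteq> {}" using assms(3) by (auto simp: pairs_def)
  then obtain x where "x \<in> e" by auto
  then have "x \<in> V" "{e' \<in> {e}. x \<in> e'} = {e}" using assms(3) by (auto simp: pairs_def)
  then have a: "0 \<le> a" "a \<le> 1"
    using mu_nonneg[OF assms(3)] mu_at_le_1[of "{e}" x] assms(3) by (auto simp: a_def)
  have l: "0 \<le> l" "l \<le> 1" "l * s = s - t" using assms by (auto simp: l_def field_simps)
  have "l *\<^sub>R (- s * a) = - ((l * s) * a)" by simp
  also have "\<dots> = - (s - t) * a" unfolding l(3) by (rule minus_mult_left)
  finally have "l *\<^sub>R (- s * a) = - (s - t) * a" .
  \<comment> \<open>Convexity of \<open>exp\<close> between \<open>0\<close> and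
    \<open>- s * a\<close>, at the point \<open>- (s - t) * a\<close>.\<close>
  moreover have "exp ((1 - l) *\<^sub>R 0 + l *\<^sub>R (- s * a)) \<le> (1 - l) * exp 0 + l * exp (- s * a)"
    using l by (intro convex_onD[OF exp_convex]) auto
  ultimately have "exp (- (s - t) * a) \<le> 1 - l + l * exp (- s * a)" by (simp only:) simp
  then have "l * (1 - exp (- s * a)) \<le> 1 - exp (- (s - t) * a)"
    unfolding right_diff_distrib by linarith
  moreover have "exp (- t) \<le> exp (- t * a)" using a assms mult_left_mono[of a 1 t] by simp
  moreover have "0 \<le> l * (1 - exp (- s * a))" using l a assms by (intro mult_nonneg_nonneg) auto
  ultimately have "exp (- t) * (l * (1 - exp (- s * a))) \<le> exp (- t * a) * (1 - exp (- (s - t) * a))"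
    by (intro mult_mono) auto
  also have "\<dots> = exp (- t * a) - exp (- s * a)"
    by (simp add: right_diff_distrib flip: exp_add) (simp add: algebra_simps)
  finally show ?thesis
    unfolding edge_prob_def a_def[symmetric] l_def[symmetric] by (simp add: algebra_simps)
qed

text \<open>Continuity from above: the tail events decrease to the event of an infinite
  cluster.\<close>

lemma tail_tendsto_infinite:
  "(\<lambda>n. \<P>(\<omega> in percolation V \<mu> t. of_nat n \<le> cluster_size V \<omega> x))
    \<longlonglongrightarrow> \<P>(\<omega> in percolation V \<mu> t. cluster_size V \<omega> x = \<infinity>)"
proof -
  interpret P: prob_space "percolation V \<mu> t" by (rule prob_space_percolation)
  let ?A = "\<lambda>n::nat. {\<omega> \<in> space (percolation V \<mu> t). of_nat n \<le> cluster_size V \<omega> x}"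
  have "(\<lambda>n. measure (percolation V \<mu> t) (?A n)) \<longlonglongrightarrow> measure (percolation V \<mu> t) (\<Inter>n. ?A n)"
  proof (rule P.finite_Lim_measure_decseq)
    show "decseq ?A"
      by (auto simp: decseq_def intro: order_trans[OF of_nat_mono])
  qed auto
  also have "(\<Inter>n. ?A n) = {\<omega> \<in> space (percolation V \<mu> t). cluster_size V \<omega> x = \<infinity>}"
  proof (intro equalityI subsetI)
    fix \<omega> assume \<omega>: "\<omega> \<in> (\<Inter>n. ?A n)"
    have "\<not> cluster_size V \<omega> x < \<infinity>"
      using \<omega> ennreal_Ex_less_of_nat[of "cluster_size V \<omega> x"] by (auto simp: infinity_ennreal_def not_less[symmetric])
    then show "\<omega> \<in> {\<omega> \<in> space (percolation V \<mu> t). cluster_size V \<omega> x = \<infinity>}"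
      using \<omega> by (auto simp: less_top[symmetric])
  qed auto
  finally show ?thesis .
qed

lemma exponential_decay:
  assumes "transitive_model V \<mu>" "v \<in> V" "0 \<le> t" "t < s"
    and "\<P>(\<omega> in percolation V \<mu> s. cluster_size V \<omega> v = \<infinity>) = 0"
  obtains h where "0 < h"
    "\<And>n. \<P>(\<omega> in percolation V \<mu> t. of_nat n \<le> cluster_size V \<omega> v) \<le> 2 * exp (- h * real n)"
proof -
  \<comment> \<open>Half of the gap from \<open>edge_prob_gap\<close>, so that also
    \<open>\<epsilon> \<le> 1 / 2\<close> and the normalising constant of the tilt stays at least
    \<open>1 / 2\<close>.\<close>
  define \<epsilon> where "\<epsilon> = exp (- t) * ((s - t) / s) / 2"
  have "exp (- t) * ((s - t) / s) \<le> 1 * 1"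
    using assms(3,4) by (intro mult_mono) (auto simp: field_simps)
  then have \<epsilon>: "0 < \<epsilon>" "\<epsilon> \<le> 1 / 2"
    using assms(3,4) by (auto simp: \<epsilon>_def)
  let ?P = "\<lambda>n x. \<P>(\<omega> in percolation V \<mu> s. of_nat n \<le> cluster_size V \<omega> x)"
  have "\<forall>\<^sub>F n in sequentially. ?P n v < \<epsilon> / 2"
    using tail_tendsto_infinite[of s v] \<epsilon> unfolding assms(5) by (intro order_tendstoD(2)) auto
  then obtain N where N: "?P N v < \<epsilon> / 2"
    by (auto simp: eventually_sequentially)
  \<comment> \<open>Chosen so that \<open>h * N \<le> \<epsilon> / 2\<close>; the \<open>+ 1\<close>
    keeps the denominator positive.\<close>
  define h where "h = \<epsilon> / (2 * (real N + 1))"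
  have h: "0 < h" using \<epsilon> by (simp add: h_def)
  have "h * N \<le> \<epsilon> / 2"
    using \<epsilon> by (simp add: h_def field_simps)
  then have hN: "1 - \<epsilon> / 2 \<le> exp (- h * N)"
    using exp_ge_add_one_self[of "- h * N"] by simp
  have s: "0 \<le> s" using assms by simp
  have bnds: "0 \<le> edge_prob s e \<and> edge_prob s e \<le> 1" if "e \<in> pairs V" for e
    using edge_prob_bounds[OF that s] .
  \<comment> \<open>Clusters smaller than \<open>N\<close> have tilt at least
    \<open>1 - \<epsilon> / 2\<close> and occur with probability at least
    \<open>1 - \<epsilon> / 2\<close>. Transitivity makes the choice of \<open>N\<close> uniform in
    \<open>y\<close>.\<close>
  have lower: "1 - \<epsilon> \<le> bexp (edge_prob s) U (\<lambda>X. exp (- h * card (reach X {y})))"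
    if U: "finite U" "U \<subseteq> pairs V" and y: "y \<in> V" for U y
  proof -
    let ?Q = "bexp (edge_prob s) U (\<lambda>X. of_bool (N \<le> card (reach X {y})))"
    have "?Q \<le> \<epsilon> / 2"
      using bexp_tail_le[OF U s, of N y] transitive_tail_le[OF assms(1) y assms(2), of s N] N by simp
    then have "(1 - \<epsilon> / 2) * (1 - \<epsilon> / 2) \<le> exp (- h * N) * (1 - ?Q)"
      using hN \<epsilon> by (intro mult_mono) auto
    also have "\<dots> = bexp (edge_prob s) U (\<lambda>X. exp (- h * N) * (1 - of_bool (N \<le> card (reach X {y}))))"
      using U by (simp add: bexp_cmult bexp_diff bexp_const)
    also have "\<dots> \<le> bexp (edge_prob s) U (\<lambda>X. exp (- h * card (reach X {y})))"
      using bnds U h by (intro bexp_mono) auto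
    finally have "(1 - \<epsilon> / 2) * (1 - \<epsilon> / 2) \<le> bexp (edge_prob s) U (\<lambda>X. exp (- h * card (reach X {y})))" .
    moreover have "1 - \<epsilon> \<le> (1 - \<epsilon> / 2) * (1 - \<epsilon> / 2)" by (simp add: field_simps)
    ultimately show ?thesis by linarith
  qed
  have edges: "edge_prob t e \<le> (1 - \<epsilon>) * edge_prob s e" if "e \<in> pairs V" for e
  proof -
    have "edge_prob t e \<le> (1 - 2 * \<epsilon>) * edge_prob s e"
      using edge_prob_gap[OF assms(3,4) that] by (simp add: \<epsilon>_def)
    also have "\<dots> \<le> (1 - \<epsilon>) * edge_prob s e"
      using \<epsilon> bnds[OF that] by (intro mult_right_mono) auto
    finally show ?thesis .
  qed
  have tail: "bexp (edge_prob t) U (\<lambda>X. of_bool (n \<le> card (reach X {v}))) \<le> 2 * exp (- h * n)"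
    if U: "finite U" "U \<subseteq> pairs V" for U n
  proof -
    let ?T = "bexp (edge_prob t) U (\<lambda>X. of_bool (n \<le> card (reach X {v})))"
    let ?L = "bexp (edge_prob s) U (\<lambda>X. exp (- h * card (reach X {v})))"
    have "?T * ?L \<le> bexp (edge_prob s) U
        (\<lambda>X. of_bool (n \<le> card (reach X {v})) * exp (- h * card (reach X {v})))"
    proof (rule tilted_domination[where E = "pairs V" and m = \<epsilon> and f = "\<lambda>k. of_bool (n \<le> k)"])
      show "1 - \<epsilon> \<le> bexp (edge_prob s) W (\<lambda>X. exp (- h * card (reach X {y})))"
        if "finite W" "W \<subseteq> pairs V" "y \<in> \<Union> (pairs V)" for W y
        using that by (intro lower) (auto simp: pairs_def)
      show "mono (\<lambda>k. of_bool (n \<le> k) :: real)" by (auto simp: mono_def)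
    qed (use U h edges bnds edge_prob_bounds[OF _ assms(3)] finite_edge in auto)
    also have "\<dots> \<le> bexp (edge_prob s) U (\<lambda>X. exp (- h * n))"
      using bnds U h by (intro bexp_mono) auto
    finally have TL: "?T * ?L \<le> exp (- h * n)" using U by (simp add: bexp_const)
    have "0 \<le> ?T"
      unfolding bexp_def using edge_prob_bounds[OF _ assms(3)] U
      by (intro sum_nonneg mult_nonneg_nonneg prod_nonneg) auto
    \<comment> \<open>The normalising constant is at least
      \<open>1 - \<epsilon> \<ge> 1 / 2\<close>, which is the origin of the factor 2.\<close>
    then have "?T * (1 / 2) \<le> ?T * ?L"
      using lower[OF U assms(2)] \<epsilon> by (intro mult_left_mono) auto
    with TL show ?thesis by linarith
  qed
  have "\<P>(\<omega> in percolation V \<mu> t. of_nat n \<le> cluster_size V \<omega> v) \<le> 2 * exp (- h * n)" for n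
    by (rule LIMSEQ_le_const2[OF bexp_tail_tendsto[OF assms(3)]])
      (use tail finite_edges_upto edges_upto_subset in auto)
  with h show thesis by (rule that)
qed

lemma transitive_imp_ANB:
  assumes "transitive_model V \<mu>"
  shows "ANB_property V \<mu>"
  unfolding ANB_property_def
proof (intro ballI allI impI)
  fix v t assume v: "v \<in> V" "0 \<le> t" "ereal t < critical_value V \<mu> v"
  \<comment> \<open>By definition of the supremum there is a larger parameter without infinite
    cluster.\<close>
  then obtain s where s: "\<P>(\<omega> in percolation V \<mu> s. cluster_size V \<omega> v = \<infinity>) = 0" "t < s"
    unfolding critical_value_def less_SUP_iff by auto
  obtain h where h: "0 < h"
    "\<And>n. \<P>(\<omega> in percolation V \<mu> t. of_nat n \<le> cluster_size V \<omega> v) \<le> 2 * exp (- h * real n)"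
    using exponential_decay[OF assms v(1,2) s(2,1)] by blast
  have "\<P>(\<omega> in percolation V \<mu> t. of_nat n \<le> cluster_size V \<omega> v) \<le> exp (- (h / 2) * real n)"
    if "nat \<lceil>2 / h\<rceil> \<le> n" for n
  proof -
    \<comment> \<open>Beyond this threshold half of the rate absorbs the factor 2, since
      \<open>exp (h / 2 * n) \<ge> 1 + 1\<close>.\<close>
    have "2 / h \<le> n" using that by linarith
    then have "1 \<le> h / 2 * n" using h(1) by (simp add: field_simps)
    then have "2 \<le> exp (h / 2 * n)" using exp_ge_add_one_self[of "h / 2 * n"] by linarith
    then have "2 * exp (- h * n) \<le> exp (h / 2 * n) * exp (- h * n)" by (intro mult_right_mono) auto
    also have "\<dots> = exp (- (h / 2) * n)" by (simp add: field_simps flip: exp_add)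
    finally show ?thesis using h(2)[of n] by linarith
  qed
  then show "\<exists>c>0. \<forall>\<^sub>F n in sequentially.
      \<P>(\<omega> in percolation V \<mu> t. of_nat n \<le> cluster_size V \<omega> v) \<le> exp (- c * real n)"
    using h(1) by (intro exI[of _ "h / 2"] conjI eventually_sequentiallyI[of "nat \<lceil>2 / h\<rceil>"]) auto
qed

end

theorem theorem4p10:
  fixes V :: "'v set" and \<mu> :: "'v set \<Rightarrow> real" and v :: 'v
  assumes "long_range_model V \<mu>"
    and "v \<in> V"
  defines "I \<equiv> {t. 0 \<le> t \<and> ereal t < critical_value V \<mu> v}"
  shows "(ANB_property V \<mu> \<longrightarrow>
            (\<forall>t\<in>I. susceptibility V \<mu> v t < \<infinity>) \<and>
            (\<lambda>t. enn2real (susceptibility V \<mu> v t)) real_analytic_on I) \<and>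
         (transitive_model V \<mu> \<longrightarrow> ANB_property V \<mu>)"
proof (intro conjI impI)
  interpret long_range V \<mu> using assms(1) by unfold_locales
  show "transitive_model V \<mu> \<Longrightarrow> ANB_property V \<mu>" by (rule transitive_imp_ANB)
  assume ANB: "ANB_property V \<mu>"
  have moment: "\<exists>(d::real) B. 0 < d \<and> (\<forall>U. finite U \<longrightarrow> U \<subseteq> pairs V \<longrightarrow>
      bexp (edge_prob t) U (\<lambda>X. card (reach X {v}) * exp (d * card (reach X {v}))) \<le> B)"
    if "t \<in> I" for t
  proof -
    have t: "0 \<le> t" "ereal t < critical_value V \<mu> v" using that by (auto simp: I_def)
    then obtain c where c: "0 < c" "\<forall>\<^sub>F n in sequentially.
        \<P>(\<omega> in percolation V \<mu> t. of_nat n \<le> cluster_size V \<omega> v) \<le> exp (- c * real n)"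
      using ANB assms(2) unfolding ANB_property_def by blast
    obtain B where "\<And>U. finite U \<Longrightarrow> U \<subseteq> pairs V \<Longrightarrow>
        bexp (edge_prob t) U (\<lambda>X. card (reach X {v}) * exp (c / 2 * card (reach X {v}))) \<le> B"
      by (rule exponential_moment_bound[OF t(1) c]) blast
    then show ?thesis using c(1) by (intro exI[of _ "c / 2"] exI[of _ B]) auto
  qed
  show fin: "\<forall>t\<in>I. susceptibility V \<mu> v t < \<infinity>"
  proof
    fix t assume t: "t \<in> I"
    then obtain d :: real and B where "0 < d" "\<And>U. finite U \<Longrightarrow> U \<subseteq> pairs V \<Longrightarrow>
        bexp (edge_prob t) U (\<lambda>X. card (reach X {v}) * exp (d * card (reach X {v}))) \<le> B"
      using moment by blast
    then show "susceptibility V \<mu> v t < \<infinity>"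
      using t by (intro susceptibility_finite[of t d]) (auto simp: I_def)
  qed
  show "(\<lambda>t. enn2real (susceptibility V \<mu> v t)) real_analytic_on I"
    unfolding real_analytic_on_def
  proof
    fix t assume "t \<in> I"
    then have t: "0 \<le> t" "ereal t < critical_value V \<mu> v" by (auto simp: I_def)
    \<comment> \<open>A parameter strictly between \<open>t\<close> and the critical value provides
      the room to the right that the holomorphic extension requires.\<close>
    then obtain s where s: "t < s" "ereal s < critical_value V \<mu> v"
      using ereal_dense2 by fastforce
    then have "s \<in> I" using t by (simp add: I_def)
    then obtain d :: real and B where d: "0 < d" and B: "\<And>U. finite U \<Longrightarrow> U \<subseteq> pairs V \<Longrightarrow>
        bexp (edge_prob s) U (\<lambda>X. card (reach X {v}) * exp (d * card (reach X {v}))) \<le> B"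
      using moment by blast
    show "\<exists>r>0. \<exists>F. F holomorphic_on ball (complex_of_real t) r \<and>
        (\<forall>y\<in>I. complex_of_real y \<in> ball (complex_of_real t) r \<longrightarrow>
          F (complex_of_real y) = complex_of_real (enn2real (susceptibility V \<mu> v y)))"
      using susceptibility_holomorphic_extension[OF t(1) s(1) d assms(2) B] fin
      unfolding I_def by blast
  qed
qed

end
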